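(* Let $d$ be a positive integer. 1. For every $n\ge d+1$ we have $D_d(d,n)=n$; that is, the maximum number of cliques of size $d$ in a diameter graph on $n$ vertices in $\mathbb{R}^d$ equals $n$. 2. For every real $r>1/\sqrt2$, every diameter graph $G$ on $n$ vertices on the sphere $S^d_r$ (with edges of unit Euclidean length) has at most $n$ cliques of size $d$.
   Context: A graph $G=(V,E)$ is a diameter graph in $\mathbb{R}^d$ if $V\subset\mathbb{R}^d$ is a finite set of diameter $1$ and the edges of $G$ are exactly the pairs of vertices at Euclidean distance $1$. $S^d_r$ denotes a $d$-dimensional sphere of radius $r$ (e.g. the set of points of $\mathbb{R}^{d+1}$ at distance $r$ from the origin). A diameter graph on $S^d_r$ is defined in the same way with $V\subset S^d_r$ finite of diameter $1$, where distances (and the diameter) are Euclidean distances in the ambient space $\mathbb{R}^{d+1}$. A clique of size $d$ (a $d$-clique) is a set of $d$ pairwise adjacent vertices. $D_d(l,n)$ denotes the maximum number of cliques of size $l$ in a diameter graph on $n$ vertices in $\mathbb{R}^d$. *)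

theory Defs
  imports "HOL-Analysis.Analysis" "HOL-Library.Ramsey"
begin

definition diameter_graph :: "'a::euclidean_space set \<Rightarrow> 'a set set \<Rightarrow> bool" where
  "diameter_graph V E \<longleftrightarrow>
     finite V \<and> diameter V = 1 \<and> E = {{x, y} | x y. x \<in> V \<and> y \<in> V \<and> dist x y = 1}"

definition cliques :: "nat \<Rightarrow> 'a set \<Rightarrow> 'a set set \<Rightarrow> 'a set set" where
  "cliques l V E = {K \<in> nsets V l. clique K E}"

text \<open>
  The maximum number of \<open>l\<close>-cliques of a diameter graph on \<open>n\<close> vertices in the space \<open>'a\<close>.
  The set is finite by the lemma below. It is nonempty exactly if there is a diameter graph on
  \<open>n\<close> vertices, i.e. for \<open>n \<ge> 2\<close>; for smaller \<open>n\<close> the value is unspecified.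
\<close>

definition max_cliques :: "'a::euclidean_space itself \<Rightarrow> nat \<Rightarrow> nat \<Rightarrow> nat" where
  "max_cliques _ l n =
     Max {card (cliques l V E) | (V :: 'a set) E. diameter_graph V E \<and> card V = n}"

lemma finite_clique_counts:
  "finite {card (cliques l V E) | (V :: 'a::euclidean_space set) E. diameter_graph V E \<and> card V = n}"
proof (rule finite_subset)
  have "card (cliques l V E) \<le> card V choose l" if "diameter_graph V E" for V :: "'a set" and E
  proof -
    have "finite V" using that by (simp add: diameter_graph_def)
    then have "card (cliques l V E) \<le> card (nsets V l)"
      by (intro card_mono[OF finite_imp_finite_nsets]) (auto simp: cliques_def)
    then show ?thesis by simp
  qed
  then show "{card (cliques l V E) | (V :: 'a set) E. diameter_graph V E \<and> card V = n} \<subseteq> {..n choose l}"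
    by auto
qed simp

end

theory Submission
  imports Defs
begin

text \<open>
  A point \<open>x\<close> is lifted to the vector \<open>(x, x \<bullet> x, 1)\<close>, and the lifted space carries the Lorentz form
  for which two lifts have the product \<open>1 - (dist x y)\<^sup>2\<close>. Unit cliques become orthonormal systems, and
  a set of diameter at most 1 becomes a set of unit vectors with nonnegative products. The lifts of
  \<open>\<real>\<^sup>d\<close>, and those of a \<open>d\<close>-dimensional sphere of radius \<open>r > 1 / sqrt 2\<close>, lie in a subspace of
  dimension \<open>d + 2\<close> in which the last coordinate (the height) is the product with a fixed vector of
  nonpositive square. For the sphere this is where the bound on \<open>r\<close> enters. The upper bound is proved
  in this common model (\<open>diameter_model\<close>).

  The geometric heart (\<open>cliques_share\<close>) is that two \<open>d\<close>-cliques share at least \<open>d - 2\<close> vertices. After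
  removing the common vertices it says that two disjoint unit simplices \<open>A\<close>, \<open>B\<close> with \<open>m \<ge> 3\<close> vertices
  each, whose lifts span a space of dimension at most \<open>m + 2\<close> (at most \<open>m + 1\<close> if the form is semidefinite
  on it), do not have all cross distances at most 1.
  Let \<open>C\<close> be the matrix of products; its entries lie in \<open>[0, 1)\<close>. A linear relation
  \<open>\<Sum> x a \<cdot> lift a = \<Sum> y b \<cdot> lift b\<close> yields \<open>x = C y\<close>, \<open>y = C\<^sup>T x\<close> and \<open>\<Sum> x = \<Sum> y\<close>. On relations consider
  the excess \<open>\<Sum> max x 0 - \<Sum> max y 0\<close>, which does not change when the relation is negated. If \<open>y\<close> has at
  most three nonzero coordinates, one of its signs occurs at most once; since the entries of \<open>C\<close> are
  less than 1, the excess is then positive, unless all coefficients have the same sign. By symmetry it is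
  negative if \<open>x\<close> has at most three nonzero coordinates. For dimension reasons there are relations of both kinds, and a path between them crosses
  excess 0. There the Lorentz form forces the positive part of the relation to be a relation
  itself (\<open>comb_pos_zero\<close>). This is a contradiction if there are no nonzero relations with
  nonnegative coefficients. In general one of maximal support is split off (\<open>maximal_relation\<close>), and
  what remains is too small unless the form is semidefinite on the lifts of \<open>A \<union> B\<close>, a case that is
  refuted separately (\<open>not_semidefinite\<close>).

  The bound then follows by induction on the number of vertices. If some \<open>(d - 1)\<close>-clique has three
  extensions to \<open>d\<close>-cliques, the new vertices lie on an arc, and the middle one belongs to no
  other \<open>d\<close>-clique (\<open>removable_vertex\<close>); delete it. Otherwise every \<open>(d - 1)\<close>-set lies in at most two
  \<open>d\<close>-cliques. Together with the large intersections this bounds the number of cliques through a vertex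
  outside the common core of all cliques by \<open>d\<close> minus the size of the core (\<open>degree_le\<close>), and double
  counting finishes the proof.

  For the lower bound in \<open>\<real>\<^sup>d\<close>, take a regular unit simplex, remove two vertices \<open>p\<close>, \<open>q\<close>, and put any
  number of points on the short arc from \<open>p\<close> to \<open>q\<close> of the circle of points at distance 1 from the
  remaining vertices (\<open>ex_many_cliques\<close>).
\<close>

section \<open>Lifting points to a Lorentz space\<close>

text \<open>
  The product \<open>lform\<close> of two lifts turns the squared distance into a bilinear expression. It
  is the Lorentz form of sphere geometry in \<open>'a\<close>, with a point \<open>x\<close> standing for the sphere of radius
  \<open>1 / sqrt 2\<close> about \<open>x\<close>: two such spheres are orthogonal iff their centres have distance 1.
\<close>

definition lift :: "'a::euclidean_space \<Rightarrow> 'a \<times> real \<times> real" where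
  "lift x = (x, x \<bullet> x, 1)"

definition height :: "'a \<times> real \<times> real \<Rightarrow> real" where
  "height z = snd (snd z)"

definition lform :: "'a::euclidean_space \<times> real \<times> real \<Rightarrow> 'a \<times> real \<times> real \<Rightarrow> real" where
  "lform u v = 2 * (fst u \<bullet> fst v) - fst (snd u) * height v - height u * fst (snd v)
     + height u * height v"

lemma lform_commute: "lform u v = lform v u"
  by (simp add: lform_def inner_commute algebra_simps)

lemma linear_lform: "linear (\<lambda>u. lform u v)"
  by (rule linearI) (auto simp: lform_def height_def inner_add_left algebra_simps)

lemma linear_height: "linear height"
  by (rule linearI) (auto simp: height_def)

lemma lform_sum_left:
  "lform (\<Sum>i\<in>I. f i *\<^sub>R g i) v = (\<Sum>i\<in>I. f i * lform (g i) v)"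
  by (simp add: linear_sum[OF linear_lform] linear_cmul[OF linear_lform])

lemma lform_add_left: "lform (u + u') v = lform u v + lform u' v"
  and lform_diff_left: "lform (u - u') v = lform u v - lform u' v"
  and lform_scale_left: "lform (r *\<^sub>R u) v = r * lform u v"
  and lform_zero_left [simp]: "lform 0 v = 0"
  by (simp_all add: lform_def height_def inner_add_left inner_diff_left algebra_simps)

lemma lform_add_right: "lform v (u + u') = lform v u + lform v u'"
  and lform_diff_right: "lform v (u - u') = lform v u - lform v u'"
  and lform_scale_right: "lform v (r *\<^sub>R u) = r * lform v u"
  and lform_sum_right: "lform v (\<Sum>i\<in>I. f i *\<^sub>R g i) = (\<Sum>i\<in>I. f i * lform v (g i))"
  using lform_add_left lform_diff_left lform_scale_left lform_sum_left
  by (simp_all add: lform_commute[of v])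

lemmas lform_simps = lform_add_left lform_diff_left lform_scale_left lform_sum_left
  lform_add_right lform_diff_right lform_scale_right lform_sum_right

lemma height_simps:
  "height (u + v) = height u + height v" "height (u - v) = height u - height v"
  "height (r *\<^sub>R u) = r * height u" "height 0 = 0" "height (- u) = - height u"
  "height (\<Sum>i\<in>I. f i *\<^sub>R g i) = (\<Sum>i\<in>I. f i * height (g i))"
  by (simp_all add: linear_sum[OF linear_height] linear_cmul[OF linear_height])
    (simp_all add: height_def)

lemma height_lift [simp]: "height (lift x) = 1"
  by (simp add: height_def lift_def)

definition slack :: "'a::metric_space \<Rightarrow> 'a \<Rightarrow> real" where
  "slack a b = 1 - (dist a b)\<^sup>2"

lemma slack_commute: "slack a b = slack b a"
  by (simp add: slack_def dist_commute)

lemma lform_lift: "lform (lift x) (lift y) = slack x y"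
  by (simp add: slack_def lform_def lift_def height_def dist_norm power2_norm_eq_inner inner_diff_left
      inner_diff_right inner_commute algebra_simps)

text \<open>
  Combinations of lifts with coefficient sum 0 are never timelike. The Lorentz signature enters most
  arguments through this fact.
\<close>

lemma lform_height_0: "height z = 0 \<Longrightarrow> lform z z = 2 * (norm (fst z))\<^sup>2"
  by (simp add: lform_def power2_norm_eq_inner)

lemma inj_lift: "inj lift"
  by (rule injI) (simp add: lift_def)

lemma dependent_lift_iff:
  assumes "finite X"
  shows "dependent (lift ` X) \<longleftrightarrow> (\<exists>f. (\<exists>v\<in>X. f v \<noteq> 0) \<and> (\<Sum>v\<in>X. f v *\<^sub>R lift v) = 0)"
proof -
  have inj: "inj_on lift X" by (rule inj_on_subset[OF inj_lift subset_UNIV])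
  have re: "(\<Sum>v\<in>lift ` X. u v *\<^sub>R v) = (\<Sum>v\<in>X. u (lift v) *\<^sub>R lift v)" for u
    using sum.reindex[OF inj, of "\<lambda>v. u v *\<^sub>R v"] by simp
  have "dependent (lift ` X) \<longleftrightarrow> (\<exists>u. (\<exists>v\<in>X. u (lift v) \<noteq> 0) \<and> (\<Sum>v\<in>X. u (lift v) *\<^sub>R lift v) = 0)"
    unfolding real_vector.dependent_finite[OF finite_imageI[OF assms]] re by simp
  also have "\<dots> \<longleftrightarrow> (\<exists>f. (\<exists>v\<in>X. f v \<noteq> 0) \<and> (\<Sum>v\<in>X. f v *\<^sub>R lift v) = 0)"
  proof
    assume "\<exists>f. (\<exists>v\<in>X. f v \<noteq> 0) \<and> (\<Sum>v\<in>X. f v *\<^sub>R lift v) = 0"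
    then obtain f where f: "\<exists>v\<in>X. f v \<noteq> 0" "(\<Sum>v\<in>X. f v *\<^sub>R lift v) = 0" by blast
    show "\<exists>u. (\<exists>v\<in>X. u (lift v) \<noteq> 0) \<and> (\<Sum>v\<in>X. u (lift v) *\<^sub>R lift v) = 0"
      using f by (intro exI[of _ "\<lambda>z. f (inv lift z)"]) (simp only: inv_f_f[OF inj_lift] simp_thms)
  next
    assume "\<exists>u. (\<exists>v\<in>X. u (lift v) \<noteq> 0) \<and> (\<Sum>v\<in>X. u (lift v) *\<^sub>R lift v) = 0"
    then obtain u where "(\<exists>v\<in>X. u (lift v) \<noteq> 0) \<and> (\<Sum>v\<in>X. u (lift v) *\<^sub>R lift v) = 0" by (elim exE)
    then show "\<exists>f. (\<exists>v\<in>X. f v \<noteq> 0) \<and> (\<Sum>v\<in>X. f v *\<^sub>R lift v) = 0"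
      by (rule exI[of _ "\<lambda>v. u (lift v)"])
  qed
  finally show ?thesis .
qed

section \<open>Two disjoint simplices of diameter at most 1\<close>

text \<open>
  This rules out relations supported by a single vertex of \<open>B\<close>: the coefficients on \<open>A\<close> would have both
  sum 1 and sum of squares 1.
\<close>

lemma sum_squares_less_sum:
  fixes f :: "'b \<Rightarrow> real"
  assumes fin: "finite S" and f: "\<And>s. s \<in> S \<Longrightarrow> 0 \<le> f s \<and> f s < 1"
    and "(\<Sum>s\<in>S. f s) = 1"
  shows "(\<Sum>s\<in>S. (f s)\<^sup>2) < 1"
proof -
  have "f s * f s \<le> f s" if "s \<in> S" for s
    using f[OF that] by (simp add: mult_left_le)
  moreover have "\<exists>s\<in>S. f s * f s < f s"
  proof -
    obtain s where "s \<in> S" "f s \<noteq> 0" using assms(3) by (metis sum.neutral zero_neq_one)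
    then show ?thesis using f[of s] by (intro bexI[of _ s]) auto
  qed
  ultimately have "(\<Sum>s\<in>S. f s * f s) < (\<Sum>s\<in>S. f s)" using fin by (intro sum_strict_mono_ex1) auto
  then show ?thesis using assms(3) by (simp add: power2_eq_square)
qed

text \<open>
  This configuration turns out to be contradictory. Two dimension hypotheses are made: the lifts span at
  most \<open>m + 2\<close> dimensions, and at most \<open>m + 1\<close> if the form is semidefinite on their span. The
  second one reflects that a semidefinite subspace of a Lorentz space of dimension \<open>m + 2\<close> is proper.
  Both are expressed by the dependence of large families of lifts.
\<close>

locale disjoint_simplices =
  fixes A B :: "'a::euclidean_space set" and m :: nat
  assumes fin: "finite A" "finite B" and disj: "A \<inter> B = {}"
    and card: "card A = m" "card B = m" and m3: "3 \<le> m"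
    and distA: "\<And>x y. x \<in> A \<Longrightarrow> y \<in> A \<Longrightarrow> x \<noteq> y \<Longrightarrow> dist x y = 1"
    and distB: "\<And>x y. x \<in> B \<Longrightarrow> y \<in> B \<Longrightarrow> x \<noteq> y \<Longrightarrow> dist x y = 1"
    and distAB: "\<And>x y. x \<in> A \<Longrightarrow> y \<in> B \<Longrightarrow> dist x y \<le> 1"
    and dep: "\<And>W. W \<subseteq> A \<union> B \<Longrightarrow> m + 3 \<le> card W \<Longrightarrow> dependent (lift ` W)"
    and dep_semidef: "\<And>W. (\<And>f. 0 \<le> lform (\<Sum>v\<in>A \<union> B. f v *\<^sub>R lift v) (\<Sum>v\<in>A \<union> B. f v *\<^sub>R lift v)) \<Longrightarrow>
      W \<subseteq> A \<union> B \<Longrightarrow> m + 2 \<le> card W \<Longrightarrow> dependent (lift ` W)"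
begin

text \<open>
  The vanishing of \<open>comb x y\<close> is a linear relation between the lifts. The sign convention makes \<open>x\<close> and
  \<open>y\<close> correspond under the matrix of slacks and its transpose.
\<close>

definition comb :: "('a \<Rightarrow> real) \<Rightarrow> ('a \<Rightarrow> real) \<Rightarrow> 'a \<times> real \<times> real" where
  "comb x y = (\<Sum>a\<in>A. x a *\<^sub>R lift a) - (\<Sum>b\<in>B. y b *\<^sub>R lift b)"

lemma slack_nonneg: "a \<in> A \<Longrightarrow> b \<in> B \<Longrightarrow> 0 \<le> slack a b"
  using distAB[of a b] by (simp add: slack_def power_le_one)

lemma slack_less_1: "a \<in> A \<Longrightarrow> b \<in> B \<Longrightarrow> slack a b < 1"
  using disj by (auto simp: slack_def)

lemma lform_sumA: "a \<in> A \<Longrightarrow> (\<Sum>a'\<in>A. x a' * lform (lift a') (lift a)) = x a"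
proof -
  assume a: "a \<in> A"
  have "(\<Sum>a'\<in>A. x a' * lform (lift a') (lift a)) = (\<Sum>a'\<in>A. if a' = a then x a else 0)"
    using a by (intro sum.cong) (auto simp: lform_lift slack_def distA)
  then show ?thesis using fin a by simp
qed

lemma lform_sumB: "b \<in> B \<Longrightarrow> (\<Sum>b'\<in>B. x b' * lform (lift b') (lift b)) = x b"
proof -
  assume a: "b \<in> B"
  have "(\<Sum>b'\<in>B. x b' * lform (lift b') (lift b)) = (\<Sum>b'\<in>B. if b' = b then x b else 0)"
    using a by (intro sum.cong) (auto simp: lform_lift slack_def distB)
  then show ?thesis using fin a by simp
qed

lemma lform_comb_A:
  "a \<in> A \<Longrightarrow> lform (comb x y) (lift a) = x a - (\<Sum>b\<in>B. slack a b * y b)"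
  unfolding comb_def lform_diff_left lform_sum_left
  by (simp only: lform_sumA) (simp add: lform_lift mult.commute slack_commute[of a])

lemma lform_comb_B:
  "b \<in> B \<Longrightarrow> lform (comb x y) (lift b) = (\<Sum>a\<in>A. slack a b * x a) - y b"
  unfolding comb_def lform_diff_left lform_sum_left
  by (simp only: lform_sumB) (simp add: lform_lift mult.commute)

lemma lform_comb:
  "lform (comb x y) (comb x' y') =
     (\<Sum>a\<in>A. x' a * (x a - (\<Sum>b\<in>B. slack a b * y b))) - (\<Sum>b\<in>B. y' b * ((\<Sum>a\<in>A. slack a b * x a) - y b))"
proof -
  have "lform (comb x y) (comb x' y') =
     (\<Sum>a\<in>A. x' a * lform (comb x y) (lift a)) - (\<Sum>b\<in>B. y' b * lform (comb x y) (lift b))"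
    by (simp only: comb_def[of x' y'] lform_diff_right lform_sum_right)
  then show ?thesis by (simp add: lform_comb_A lform_comb_B)
qed

lemma height_comb: "height (comb x y) = sum x A - sum y B"
  by (simp add: comb_def height_simps)

lemma relation_eqs:
  assumes "comb x y = 0"
  shows "\<And>a. a \<in> A \<Longrightarrow> x a = (\<Sum>b\<in>B. slack a b * y b)"
    and "\<And>b. b \<in> B \<Longrightarrow> y b = (\<Sum>a\<in>A. slack a b * x a)"
    and "sum x A = sum y B"
  using lform_comb_A[of _ x y] lform_comb_B[of _ x y] height_comb[of x y] assms
  by (auto simp: height_simps)

lemma comb_add: "comb (\<lambda>a. x a + x' a) (\<lambda>b. y b + y' b) = comb x y + comb x' y'"
  and comb_scale: "comb (\<lambda>a. r * x a) (\<lambda>b. r * y b) = r *\<^sub>R comb x y"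
  and comb_minus: "comb (\<lambda>a. - x a) (\<lambda>b. - y b) = - comb x y"
  by (simp_all add: comb_def sum.distrib scaleR_add_left scaleR_sum_right sum_negf algebra_simps)

lemma ex_relation:
  assumes "S \<subseteq> A" "T \<subseteq> B" and dp: "dependent (lift ` (S \<union> T))"
  shows "\<exists>x y. comb x y = 0 \<and> (\<forall>a\<in>A - S. x a = 0) \<and> (\<forall>b\<in>B - T. y b = 0)
    \<and> \<not> ((\<forall>a\<in>A. x a = 0) \<and> (\<forall>b\<in>B. y b = 0))"
proof -
  have fS: "finite S" "finite T" using assms fin finite_subset by auto
  obtain u where u0: "\<exists>v\<in>S \<union> T. u v \<noteq> 0" and u: "(\<Sum>v\<in>S \<union> T. u v *\<^sub>R lift v) = 0"
    using dp dependent_lift_iff[of "S \<union> T"] fS by blast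
  define x where "x a = (if a \<in> S then u a else 0)" for a
  define y where "y b = (if b \<in> T then - u b else 0)" for b
  have ST: "S \<inter> T = {}" using assms disj by auto
  have "0 = (\<Sum>v\<in>S \<union> T. u v *\<^sub>R lift v)" using u by simp
  also have "\<dots> = (\<Sum>v\<in>S. u v *\<^sub>R lift v) + (\<Sum>v\<in>T. u v *\<^sub>R lift v)"
    using fS ST by (simp add: sum.union_disjoint)
  also have "(\<Sum>v\<in>S. u v *\<^sub>R lift v) = (\<Sum>a\<in>A. x a *\<^sub>R lift a)"
    using assms fin by (intro sum.mono_neutral_cong_left) (auto simp: x_def)
  also have "(\<Sum>v\<in>T. u v *\<^sub>R lift v) = - (\<Sum>b\<in>B. y b *\<^sub>R lift b)"
    unfolding sum_negf[symmetric]
    using assms fin by (intro sum.mono_neutral_cong_left) (auto simp: y_def)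
  finally have "comb x y = 0" by (simp add: comb_def)
  moreover have "\<not> ((\<forall>a\<in>A. x a = 0) \<and> (\<forall>b\<in>B. y b = 0))"
  proof -
    consider v where "v \<in> S" "u v \<noteq> 0" | v where "v \<in> T" "u v \<noteq> 0" using u0 by auto
    then show ?thesis
    proof cases
      case (1 v)
      then have "v \<in> A" "x v \<noteq> 0" using assms by (auto simp: x_def)
      then show ?thesis by blast
    next
      case (2 v)
      then have "v \<in> B" "y v \<noteq> 0" using assms by (auto simp: y_def)
      then show ?thesis by blast
    qed
  qed
  ultimately show ?thesis by (intro exI[of _ x] exI[of _ y]) (auto simp: x_def y_def)
qed

lemma swap: "disjoint_simplices B A m"
proof
  show "dependent (lift ` W)" if "W \<subseteq> B \<union> A" "m + 3 \<le> card W" for W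
    using that dep[of W] by (simp add: Un_commute)
  show "dependent (lift ` W)"
    if "\<And>f. 0 \<le> lform (\<Sum>v\<in>B \<union> A. f v *\<^sub>R lift v) (\<Sum>v\<in>B \<union> A. f v *\<^sub>R lift v)"
      "W \<subseteq> B \<union> A" "m + 2 \<le> card W" for W
    using that dep_semidef[of W] by (simp add: Un_commute)
  show "dist x y \<le> 1" if "x \<in> B" "y \<in> A" for x y
    using distAB[OF that(2,1)] by (simp add: dist_commute)
qed (use fin disj card m3 distA distB in \<open>auto simp: dist_commute Int_commute\<close>)

abbreviation pos :: "('a \<Rightarrow> real) \<Rightarrow> 'a \<Rightarrow> real" where
  "pos x \<equiv> (\<lambda>a. max (x a) 0)"

lemma comb_pos_diff: "comb (pos x) (pos y) - comb (pos (\<lambda>a. - x a)) (pos (\<lambda>a. - y a)) = comb x y"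
proof -
  have "x = (\<lambda>a. pos x a + - pos (\<lambda>a. - x a) a)" "y = (\<lambda>a. pos y a + - pos (\<lambda>a. - y a) a)"
    by auto
  then have "comb x y = comb (\<lambda>a. pos x a + - pos (\<lambda>a. - x a) a) (\<lambda>a. pos y a + - pos (\<lambda>a. - y a) a)"
    by simp
  also have "\<dots> = comb (pos x) (pos y) - comb (pos (\<lambda>a. - x a)) (pos (\<lambda>a. - y a))"
    by (simp only: comb_add comb_minus) simp
  finally show ?thesis by simp
qed

text \<open>
  Suppose that the positive parts of a relation have equal sums. Their combination \<open>z\<close> has height 0, so its
  square is nonnegative. By the relation, \<open>z\<close> is also the combination of the negative parts; multiplying
  the two expressions leaves only products of slacks with a negative sign. Hence the square is 0, and
  then \<open>z\<close> itself vanishes.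
\<close>

lemma comb_pos_zero:
  assumes rel: "comb x y = 0" and eq: "(\<Sum>a\<in>A. pos x a) = (\<Sum>b\<in>B. pos y b)"
  shows "comb (pos x) (pos y) = 0"
proof (cases "\<exists>a\<in>A. x a > 0")
  case False
  then have "(\<Sum>a\<in>A. pos x a) = 0" by (intro sum.neutral) (auto simp: not_less max_def)
  then have "(\<Sum>b\<in>B. pos y b) = 0" using eq by linarith
  then have "\<forall>b\<in>B. pos y b = 0"
    using sum_nonneg_eq_0_iff[OF fin(2), of "pos y"] by simp
  then show ?thesis using False by (auto simp: comb_def not_less max_def intro!: sum.neutral)
next
  case True
  then obtain a0 where a0: "a0 \<in> A" "x a0 > 0" by blast
  define x' y' where "x' = pos (\<lambda>a. - x a)" and "y' = pos (\<lambda>a. - y a)"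
  define z where "z = comb (pos x) (pos y)"
  have z: "z = comb x' y'" using comb_pos_diff[of x y] rel by (simp add: z_def x'_def y'_def)
  have h: "height z = 0" using eq by (simp add: z_def height_comb)
  have x0: "x' a * pos x a = 0" "y' b * pos y b = 0" for a b by (auto simp: x'_def y'_def max_def)
  have n1: "0 \<le> (\<Sum>a\<in>A. \<Sum>b\<in>B. x' a * (slack a b * pos y b))"
    by (intro sum_nonneg mult_nonneg_nonneg slack_nonneg) (auto simp: x'_def)
  have nn: "0 \<le> pos x a * (slack a b * y' b)" if "a \<in> A" "b \<in> B" for a b
    using slack_nonneg that by (auto simp: y'_def intro!: mult_nonneg_nonneg)
  then have n2: "0 \<le> (\<Sum>a\<in>A. \<Sum>b\<in>B. pos x a * (slack a b * y' b))" by (intro sum_nonneg) auto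
  \<comment> \<open>Expand the square of \<open>z\<close> with one factor in each of its two forms.\<close>
  have "lform z z = lform (comb (pos x) (pos y)) (comb x' y')" using z z_def by simp
  also have "\<dots> = (\<Sum>a\<in>A. x' a * pos x a - x' a * (\<Sum>b\<in>B. slack a b * pos y b))
      - (\<Sum>b\<in>B. y' b * (\<Sum>a\<in>A. slack a b * pos x a) - y' b * pos y b)"
    by (simp only: lform_comb right_diff_distrib)
  also have "\<dots> = - (\<Sum>a\<in>A. \<Sum>b\<in>B. x' a * (slack a b * pos y b))
      - (\<Sum>b\<in>B. \<Sum>a\<in>A. y' b * (slack a b * pos x a))"
    unfolding x0 by (simp add: sum_negf sum_distrib_left)
  also have "(\<Sum>b\<in>B. \<Sum>a\<in>A. y' b * (slack a b * pos x a)) =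
      (\<Sum>a\<in>A. \<Sum>b\<in>B. pos x a * (slack a b * y' b))"
    by (subst sum.swap) (simp add: mult_ac)
  finally have zz: "lform z z = - (\<Sum>a\<in>A. \<Sum>b\<in>B. x' a * (slack a b * pos y b))
     - (\<Sum>a\<in>A. \<Sum>b\<in>B. pos x a * (slack a b * y' b))" .
  have "0 \<le> lform z z" using lform_height_0[OF h] by simp
  then have z0: "lform z z = 0" using zz n1 n2 by linarith
  then have fz: "fst z = 0" using lform_height_0[OF h] by auto
  have "(\<Sum>a\<in>A. \<Sum>b\<in>B. pos x a * (slack a b * y' b)) = 0" using z0 zz n1 n2 by linarith
  then have "(\<Sum>b\<in>B. pos x a0 * (slack a0 b * y' b)) = 0"
    using a0 fin nn by (subst (asm) sum_nonneg_eq_0_iff) (auto intro!: sum_nonneg)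
  \<comment> \<open>All slacks between positive \<open>x\<close> and negative \<open>y\<close> coefficients vanish, so \<open>z\<close> is orthogonal to \<open>lift a0\<close>.
    This kills the middle coordinate of \<open>z\<close>, the only one left.\<close>
  then have "(\<Sum>b\<in>B. slack a0 b * y' b) = 0"
    using a0 by (simp add: sum_distrib_left[symmetric])
  then have "lform z (lift a0) = 0"
    using a0 by (simp add: z lform_comb_A) (simp add: x'_def)
  then have "fst (snd z) = 0" using fz h by (simp add: lform_def)
  then have "z = 0" using fz h by (simp add: height_def prod_eq_iff)
  then show ?thesis by (simp add: z_def)
qed

text \<open>
  For a relation \<open>(x, y)\<close> this is the height of the combination of the positive parts.
\<close>

definition excess :: "('a \<Rightarrow> real) \<Rightarrow> ('a \<Rightarrow> real) \<Rightarrow> real" where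
  "excess x y = (\<Sum>a\<in>A. pos x a) - (\<Sum>b\<in>B. pos y b)"

lemma excess_minus:
  assumes "comb x y = 0"
  shows "excess (\<lambda>a. - x a) (\<lambda>b. - y b) = excess x y"
proof -
  have "height (comb (pos (\<lambda>a. - x a)) (pos (\<lambda>b. - y b))) = height (comb (pos x) (pos y))"
    using comb_pos_diff[of x y] assms by simp
  then show ?thesis by (simp add: height_comb excess_def)
qed

lemma excess_scale:
  assumes "0 \<le> r"
  shows "excess (\<lambda>a. r * x a) (\<lambda>b. r * y b) = r * excess x y"
proof -
  have "max (r * t) 0 = r * max t 0" for t using assms by (auto simp: max_def mult_le_0_iff zero_le_mult_iff)
  then show ?thesis by (simp add: excess_def sum_distrib_left right_diff_distrib)
qed

text \<open>
  If \<open>y j\<close> is the only positive coefficient on \<open>B\<close>, then \<open>y j = \<Sum>a\<in>A. slack a j * x a\<close>, and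
  replacing each slack by 1 in the positive terms strictly increases the sum.
\<close>

lemma excess_pos_aux:
  assumes rel: "comb x y = 0" and J: "card {b\<in>B. y b > 0} \<le> 1"
    and no: "\<not> ((\<forall>a\<in>A. x a \<le> 0) \<and> (\<forall>b\<in>B. y b \<le> 0))"
  shows "excess x y > 0"
proof (cases "\<exists>b\<in>B. y b > 0")
  case False
  then have "(\<Sum>b\<in>B. pos y b) = 0" by (intro sum.neutral) (auto simp: not_less max_def)
  moreover obtain a where "a \<in> A" "x a > 0" using no False by (auto simp: not_le not_less)
  then have "(\<Sum>a\<in>A. pos x a) > 0" using fin by (intro sum_pos2[of _ a]) auto
  ultimately show ?thesis by (simp add: excess_def)
next
  case True
  then obtain j where j: "j \<in> B" "y j > 0" by blast
  have "finite {b\<in>B. y b > 0}" using fin by simp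
  from card_le_Suc0_iff_eq[OF this] J have J1: "\<And>b. b \<in> B \<Longrightarrow> y b > 0 \<Longrightarrow> b = j"
    using j by simp
  have "pos y b = 0" if "b \<in> B - {j}" for b using J1[of b] that by (auto simp: max_def not_le)
  then have "(\<Sum>b\<in>B. pos y b) = (\<Sum>b\<in>{j}. pos y b)"
    using j fin by (intro sum.mono_neutral_right) blast+
  then have s: "(\<Sum>b\<in>B. pos y b) = y j" using j by simp
  have yj: "y j = (\<Sum>a\<in>A. slack a j * x a)" using relation_eqs(2)[OF rel] j by blast
  have le: "slack a j * x a \<le> pos x a" if "a \<in> A" for a
  proof (cases "x a \<ge> 0")
    case True
    then show ?thesis using mult_right_mono[of "slack a j" 1 "x a"] slack_less_1[OF that j(1)] by auto
  next
    case False
    then show ?thesis using slack_nonneg[OF that j(1)] by (simp add: mult_nonneg_nonpos)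
  qed
  have "\<not> (\<forall>a\<in>A. slack a j * x a \<le> 0)"
  proof
    assume "\<forall>a\<in>A. slack a j * x a \<le> 0"
    then have "(\<Sum>a\<in>A. slack a j * x a) \<le> 0" by (intro sum_nonpos) blast
    then show False using yj j by linarith
  qed
  then obtain a where a: "a \<in> A" "slack a j * x a > 0" by (auto simp: not_le)
  then have "x a > 0" using slack_nonneg[OF a(1) j(1)] by (simp add: zero_less_mult_iff)
  then have "slack a j * x a < pos x a" using slack_less_1[OF a(1) j(1)] by simp
  then have "(\<Sum>a\<in>A. slack a j * x a) < (\<Sum>a\<in>A. pos x a)"
    using le a fin by (intro sum_strict_mono_ex1) auto
  then show ?thesis using yj s by (simp add: excess_def)
qed

text \<open>
  Among at most three nonzero coefficients on \<open>B\<close>, one of the two signs occurs at most once.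
\<close>

lemma excess_pos:
  assumes rel: "comb x y = 0" and J: "card {b\<in>B. y b \<noteq> 0} \<le> 3"
    and "\<not> ((\<forall>a\<in>A. x a \<le> 0) \<and> (\<forall>b\<in>B. y b \<le> 0))" "\<not> ((\<forall>a\<in>A. x a \<ge> 0) \<and> (\<forall>b\<in>B. y b \<ge> 0))"
  shows "excess x y > 0"
proof -
  have "card {b\<in>B. y b > 0} + card {b\<in>B. y b < 0} = card ({b\<in>B. y b > 0} \<union> {b\<in>B. y b < 0})"
    using fin by (intro card_Un_disjoint[symmetric]) auto
  also have "{b\<in>B. y b > 0} \<union> {b\<in>B. y b < 0} = {b\<in>B. y b \<noteq> 0}" by auto
  finally have "card {b\<in>B. y b > 0} \<le> 1 \<or> card {b\<in>B. y b < 0} \<le> 1"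
    using J by linarith
  then consider "card {b\<in>B. y b > 0} \<le> 1" | "card {b\<in>B. - y b > 0} \<le> 1" by auto
  then show ?thesis
  proof cases
    case 1 then show ?thesis by (rule excess_pos_aux[OF rel _ assms(3)])
  next
    case 2
    have "comb (\<lambda>a. - x a) (\<lambda>b. - y b) = 0" by (simp add: comb_minus rel)
    from excess_pos_aux[OF this 2] assms(4) have "excess (\<lambda>a. - x a) (\<lambda>b. - y b) > 0" by auto
    then show ?thesis using excess_minus[OF rel] by simp
  qed
qed

lemma comb_swap: "disjoint_simplices.comb B A y x = - comb x y"
  by (simp add: comb_def disjoint_simplices.comb_def[OF swap])

lemma excess_swap: "disjoint_simplices.excess B A y x = - excess x y"
  by (simp add: excess_def disjoint_simplices.excess_def[OF swap])

lemma excess_neg: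
  assumes rel: "comb x y = 0" and J: "card {a\<in>A. x a \<noteq> 0} \<le> 3"
    and "\<not> ((\<forall>a\<in>A. x a \<le> 0) \<and> (\<forall>b\<in>B. y b \<le> 0))" "\<not> ((\<forall>a\<in>A. x a \<ge> 0) \<and> (\<forall>b\<in>B. y b \<ge> 0))"
  shows "excess x y < 0"
proof -
  have "disjoint_simplices.comb B A y x = 0" using rel by (simp add: comb_swap)
  from disjoint_simplices.excess_pos[OF swap this J] assms(3,4) have "- excess x y > 0"
    unfolding excess_swap by blast
  then show ?thesis by simp
qed

text \<open>
  Semidefiniteness means that no combination of the lifts is a timelike vector. It is excluded first.
\<close>

abbreviation semidefinite :: bool where
  "semidefinite \<equiv> \<forall>f. 0 \<le> lform (\<Sum>v\<in>A \<union> B. f v *\<^sub>R lift v) (\<Sum>v\<in>A \<union> B. f v *\<^sub>R lift v)"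

lemma sum_eq_comb: "(\<Sum>v\<in>A \<union> B. f v *\<^sub>R lift v) = comb f (\<lambda>b. - f b)"
  using fin disj by (simp add: sum.union_disjoint comb_def sum_negf)

lemma comb_eq_sum: "comb x y = (\<Sum>v\<in>A \<union> B. (if v \<in> A then x v else - y v) *\<^sub>R lift v)"
proof -
  have "b \<notin> A" if "b \<in> B" for b using disj that by auto
  then show ?thesis unfolding sum_eq_comb by (simp add: comb_def)
qed

lemma semidefinite_iff: "semidefinite \<longleftrightarrow> (\<forall>x y. 0 \<le> lform (comb x y) (comb x y))"
proof
  assume psd: semidefinite
  show "\<forall>x y. 0 \<le> lform (comb x y) (comb x y)"
    unfolding comb_eq_sum by (intro allI psd[rule_format])
next
  assume "\<forall>x y. 0 \<le> lform (comb x y) (comb x y)"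
  then show semidefinite unfolding sum_eq_comb by (intro allI) (erule allE, erule allE)
qed

lemma lform_comb_self:
  "lform (comb x y) (comb x y) =
     (\<Sum>a\<in>A. (x a)\<^sup>2) + (\<Sum>b\<in>B. (y b)\<^sup>2) - (\<Sum>a\<in>A. \<Sum>b\<in>B. slack a b * (2 * x a * y b))"
proof -
  have "lform (comb x y) (comb x y) = (\<Sum>a\<in>A. (x a)\<^sup>2) + (\<Sum>b\<in>B. (y b)\<^sup>2)
     - (\<Sum>a\<in>A. \<Sum>b\<in>B. x a * (slack a b * y b)) - (\<Sum>b\<in>B. \<Sum>a\<in>A. y b * (slack a b * x a))"
    by (simp add: lform_comb power2_eq_square right_diff_distrib sum_subtractf sum_distrib_left)
  also have "(\<Sum>b\<in>B. \<Sum>a\<in>A. y b * (slack a b * x a)) = (\<Sum>a\<in>A. \<Sum>b\<in>B. x a * (slack a b * y b))"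
    by (subst sum.swap) (simp add: mult_ac)
  finally have "lform (comb x y) (comb x y) = (\<Sum>a\<in>A. (x a)\<^sup>2) + (\<Sum>b\<in>B. (y b)\<^sup>2)
     - (\<Sum>a\<in>A. \<Sum>b\<in>B. x a * (slack a b * y b)) - (\<Sum>a\<in>A. \<Sum>b\<in>B. x a * (slack a b * y b))" .
  moreover have "(\<Sum>a\<in>A. \<Sum>b\<in>B. slack a b * (2 * x a * y b)) =
      (\<Sum>a\<in>A. \<Sum>b\<in>B. x a * (slack a b * y b)) + (\<Sum>a\<in>A. \<Sum>b\<in>B. x a * (slack a b * y b))"
    unfolding sum.distrib[symmetric] by (intro sum.cong) auto
  ultimately show ?thesis by simp
qed

text \<open>
  Perron-Frobenius in the easy direction: positive weights that the matrix of slacks and its transpose do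
  not increase bound its norm by 1. The proof is the weighted inequality \<open>2 s t \<le> s\<^sup>2 q / p + t\<^sup>2 p / q\<close>.
\<close>

lemma semidefinite_if_weights:
  assumes X: "\<And>a. a \<in> A \<Longrightarrow> X a > 0" and Y: "\<And>b. b \<in> B \<Longrightarrow> Y b > 0"
    and CY: "\<And>a. a \<in> A \<Longrightarrow> (\<Sum>b\<in>B. slack a b * Y b) \<le> X a"
    and CX: "\<And>b. b \<in> B \<Longrightarrow> (\<Sum>a\<in>A. slack a b * X a) \<le> Y b"
  shows semidefinite
  unfolding semidefinite_iff
proof (intro allI)
  fix x y
  have amgm: "2 * s * t \<le> s\<^sup>2 / p * q + t\<^sup>2 / q * p" if "p > 0" "q > 0" for s t p q :: real
  proof -
    have "s\<^sup>2 / p * q + t\<^sup>2 / q * p - 2 * s * t = (s * q - t * p)\<^sup>2 / (p * q)"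
      using that by (simp add: field_simps power2_eq_square)
    moreover have "(s * q - t * p)\<^sup>2 / (p * q) \<ge> 0" using that by simp
    ultimately show ?thesis by linarith
  qed
  have "slack a b * (2 * x a * y b) \<le>
      (x a)\<^sup>2 / X a * (slack a b * Y b) + (y b)\<^sup>2 / Y b * (slack a b * X a)"
    if "a \<in> A" "b \<in> B" for a b
    using mult_left_mono[OF amgm[OF X[OF that(1)] Y[OF that(2)]] slack_nonneg[OF that], of "x a" "y b"]
    by (simp only: distrib_left mult.left_commute)
  then have "(\<Sum>a\<in>A. \<Sum>b\<in>B. slack a b * (2 * x a * y b)) \<le>
      (\<Sum>a\<in>A. \<Sum>b\<in>B. (x a)\<^sup>2 / X a * (slack a b * Y b) + (y b)\<^sup>2 / Y b * (slack a b * X a))"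
    by (intro sum_mono)
  also have "\<dots> = (\<Sum>a\<in>A. (x a)\<^sup>2 / X a * (\<Sum>b\<in>B. slack a b * Y b))
      + (\<Sum>a\<in>A. \<Sum>b\<in>B. (y b)\<^sup>2 / Y b * (slack a b * X a))"
    by (simp only: sum.distrib sum_distrib_left)
  finally have 1: "(\<Sum>a\<in>A. \<Sum>b\<in>B. slack a b * (2 * x a * y b)) \<le>
      (\<Sum>a\<in>A. (x a)\<^sup>2 / X a * (\<Sum>b\<in>B. slack a b * Y b))
      + (\<Sum>a\<in>A. \<Sum>b\<in>B. (y b)\<^sup>2 / Y b * (slack a b * X a))" .
  have 2: "(\<Sum>a\<in>A. \<Sum>b\<in>B. (y b)\<^sup>2 / Y b * (slack a b * X a)) =
      (\<Sum>b\<in>B. (y b)\<^sup>2 / Y b * (\<Sum>a\<in>A. slack a b * X a))"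
    by (subst sum.swap) (simp add: sum_distrib_left)
  have 3: "(\<Sum>a\<in>A. (x a)\<^sup>2 / X a * (\<Sum>b\<in>B. slack a b * Y b)) \<le> (\<Sum>a\<in>A. (x a)\<^sup>2)"
  proof (intro sum_mono)
    fix a assume a: "a \<in> A"
    have "(x a)\<^sup>2 / X a * (\<Sum>b\<in>B. slack a b * Y b) \<le> (x a)\<^sup>2 / X a * X a"
      using X[OF a] CY[OF a] by (intro mult_left_mono) auto
    then show "(x a)\<^sup>2 / X a * (\<Sum>b\<in>B. slack a b * Y b) \<le> (x a)\<^sup>2" using X[OF a] by simp
  qed
  have 4: "(\<Sum>b\<in>B. (y b)\<^sup>2 / Y b * (\<Sum>a\<in>A. slack a b * X a)) \<le> (\<Sum>b\<in>B. (y b)\<^sup>2)"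
  proof (intro sum_mono)
    fix b assume b: "b \<in> B"
    have "(y b)\<^sup>2 / Y b * (\<Sum>a\<in>A. slack a b * X a) \<le> (y b)\<^sup>2 / Y b * Y b"
      using Y[OF b] CX[OF b] by (intro mult_left_mono) auto
    then show "(y b)\<^sup>2 / Y b * (\<Sum>a\<in>A. slack a b * X a) \<le> (y b)\<^sup>2" using Y[OF b] by simp
  qed
  show "0 \<le> lform (comb x y) (comb x y)" using 1 2 3 4 unfolding lform_comb_self by linarith
qed

text \<open>
  The Gram matrix \<open>C\<^sup>T C\<close> of the columns of the matrix \<open>C\<close> of slacks. In the semidefinite case
  the columns will turn out to be orthonormal.
\<close>

definition gram :: "'a \<Rightarrow> 'a \<Rightarrow> real" where
  "gram j k = (\<Sum>a\<in>A. slack a j * slack a k)"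

lemma gram_commute: "gram j k = gram k j"
  by (simp add: gram_def mult.commute)

lemma gram_nonneg: "j \<in> B \<Longrightarrow> k \<in> B \<Longrightarrow> 0 \<le> gram j k"
  unfolding gram_def by (intro sum_nonneg mult_nonneg_nonneg slack_nonneg)

lemma gram_self_le_1:
  assumes semidefinite "j \<in> B"
  shows "gram j j \<le> 1"
proof -
  define e :: "'a \<Rightarrow> real" where "e b = (if b = j then 1 else 0)" for b
  have e1: "(\<Sum>b\<in>B. e b * f b) = f j" for f
  proof -
    have "(\<Sum>b\<in>B. e b * f b) = (\<Sum>b\<in>B. if b = j then f j else 0)"
      by (intro sum.cong) (auto simp: e_def)
    then show ?thesis using fin assms(2) by simp
  qed
  have e2: "(\<Sum>b\<in>B. slack a b * e b) = slack a j" for a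
    using e1[of "slack a"] by (simp add: mult.commute)
  have "lform (comb (\<lambda>a. slack a j) e) (comb (\<lambda>a. slack a j) e) = 1 - gram j j"
    unfolding lform_comb e1 e2 by (simp add: gram_def e_def)
  moreover have "0 \<le> lform (comb (\<lambda>a. slack a j) e) (comb (\<lambda>a. slack a j) e)"
  proof -
    have "\<forall>x y. 0 \<le> lform (comb x y) (comb x y)" by (rule semidefinite_iff[THEN iffD1, OF assms(1)])
    then show ?thesis by blast
  qed
  ultimately show ?thesis by linarith
qed

text \<open>
  In the semidefinite case there are enough dependences to obtain, for any two columns \<open>j\<close>, \<open>k\<close>, a fixed
  vector of \<open>C\<^sup>T C\<close> that is supported by \<open>j\<close> and \<open>k\<close>. Neither coefficient vanishes, because a relation
  supported by one vertex \<open>l\<close> of \<open>B\<close> would make both the sum and the sum of squares of column \<open>l\<close>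
  equal to 1.
\<close>

lemma pair_relation:
  assumes semidefinite "j \<in> B" "k \<in> B" "j \<noteq> k"
  obtains s t where "s \<noteq> 0" "t \<noteq> 0"
    "\<And>b. b \<in> B \<Longrightarrow> gram b j * s + gram b k * t = (if b = j then s else if b = k then t else 0)"
proof -
  have jk: "{j, k} \<subseteq> B" using assms by auto
  have "A \<inter> {j, k} = {}" using assms disj by auto
  then have "card (A \<union> {j, k}) = m + 2" using card fin assms by (simp add: card_Un_disjoint)
  moreover have "A \<union> {j, k} \<subseteq> A \<union> B" using jk by auto
  ultimately have "dependent (lift ` (A \<union> {j, k}))"
    by (intro dep_semidef[OF assms(1)[rule_format]]) simp_all
  from ex_relation[OF order_refl jk this] obtain x y where rel: "comb x y = 0"
    and y0: "\<forall>b\<in>B - {j, k}. y b = 0" and nz: "\<not> ((\<forall>a\<in>A. x a = 0) \<and> (\<forall>b\<in>B. y b = 0))"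
    by blast
  note eqs = relation_eqs[OF rel]
  have sumB: "(\<Sum>b\<in>B. f b * y b) = f j * y j + f k * y k" for f :: "'a \<Rightarrow> real"
  proof -
    have "(\<Sum>b\<in>B. f b * y b) = (\<Sum>b\<in>{j,k}. f b * y b)"
      using fin jk y0 by (intro sum.mono_neutral_right) auto
    then show ?thesis using assms by simp
  qed
  have x: "x a = slack a j * y j + slack a k * y k" if "a \<in> A" for a
    using eqs(1)[OF that] sumB by simp
  have g: "gram b j * y j + gram b k * y k = y b" if "b \<in> B" for b
    using eqs(2)[OF that]
    by (simp add: x gram_def distrib_left sum.distrib sum_distrib_left mult_ac cong: sum.cong)
  have sy: "sum y B = y j + y k" using sumB[of "\<lambda>_. 1"] by simp
  have False if "l \<in> B" "y l \<noteq> 0" "\<And>b. b \<in> B \<Longrightarrow> b \<noteq> l \<Longrightarrow> y b = 0" for l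
  proof -
    have sl: "(\<Sum>b\<in>B. f b * y b) = f l * y l" for f :: "'a \<Rightarrow> real"
    proof -
      have "(\<Sum>b\<in>B. f b * y b) = (\<Sum>b\<in>{l}. f b * y b)"
        using fin that by (intro sum.mono_neutral_right) auto
      then show ?thesis by simp
    qed
    have xl: "x a = slack a l * y l" if "a \<in> A" for a using eqs(1)[OF that] sl by simp
    have "y l * (\<Sum>a\<in>A. slack a l) = y l * 1"
      using eqs(3) sl[of "\<lambda>_. 1"] by (simp add: xl sum_distrib_left mult.commute)
    then have s1: "(\<Sum>a\<in>A. slack a l) = 1" using that(2) by simp
    have "y l * (\<Sum>a\<in>A. (slack a l)\<^sup>2) = y l * 1"
      using eqs(2)[OF that(1)] by (simp add: xl sum_distrib_left power2_eq_square mult_ac)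
    then have "(\<Sum>a\<in>A. (slack a l)\<^sup>2) = 1" using that(2) by simp
    moreover have "(\<Sum>a\<in>A. (slack a l)\<^sup>2) < 1"
      using fin s1 slack_nonneg[OF _ that(1)] slack_less_1[OF _ that(1)]
      by (intro sum_squares_less_sum) auto
    ultimately show False by simp
  qed
  note single = this
  have "y j \<noteq> 0 \<or> y k \<noteq> 0"
  proof (rule ccontr)
    assume "\<not> ?thesis"
    then have "\<forall>b\<in>B. y b = 0" "\<forall>a\<in>A. x a = 0" using y0 x by auto
    then show False using nz by blast
  qed
  then have "y j \<noteq> 0" "y k \<noteq> 0" using single[of j] single[of k] y0 assms by auto
  then show thesis using that[of "y j" "y k"] g y0 by (auto split: if_splits)
qed

text \<open>
  Nonnegativity does the work. If the fixed vector supported by \<open>j\<close> and \<open>k\<close> has coefficients of opposite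
  signs, then, as the columns have norm at most 1, columns \<open>j\<close> and \<open>k\<close> are orthogonal unit vectors; if
  the signs agree, then every third column is orthogonal to both. A third column \<open>l\<close>, which exists by
  \<open>m \<ge> 3\<close>, settles the latter case by comparing with the pair \<open>j\<close>, \<open>l\<close>.
\<close>

lemma columns_orthogonal:
  assumes psd: semidefinite and jk: "j \<in> B" "k \<in> B" "j \<noteq> k"
  shows "gram j k = 0"
proof -
  have "card (B - {j, k}) > 0" using fin card m3 jk by (simp add: card_Diff_subset)
  then obtain l where l: "l \<in> B" "l \<noteq> j" "l \<noteq> k" by (auto simp: card_gt_0_iff)
  have mixed: "gram p p = 1 \<and> gram p q = 0"
    if "p \<in> B" "q \<in> B" "s * t < 0" "gram p p * s + gram p q * t = s" for p q s t
  proof -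
    have "s * (gram p p * s + gram p q * t) = s * s" using that(4) by simp
    then have e: "s * s * (1 - gram p p) + gram p q * (- (s * t)) = 0" by (simp add: algebra_simps)
    have "0 \<le> s * s * (1 - gram p p)" "0 \<le> gram p q * (- (s * t))"
      using gram_self_le_1[OF psd that(1)] gram_nonneg[OF that(1,2)] that(3)
      by (auto intro!: mult_nonneg_nonneg simp: mult_nonneg_nonpos)
    then have "s * s * (1 - gram p p) = 0" "gram p q * (- (s * t)) = 0" using e by linarith+
    then show ?thesis using that(3) by auto
  qed
  have same: "gram b p = 0 \<and> gram b q = 0"
    if "p \<in> B" "q \<in> B" "b \<in> B" "s * t > 0" "gram b p * s + gram b q * t = 0" for p q b s t
  proof -
    have "s * (gram b p * s + gram b q * t) = 0" using that(5) by simp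
    then have e: "gram b p * (s * s) + gram b q * (s * t) = 0" by (simp add: algebra_simps)
    have "0 \<le> gram b p * (s * s)" "0 \<le> gram b q * (s * t)"
      using gram_nonneg that by (auto intro!: mult_nonneg_nonneg)
    then have "gram b p * (s * s) = 0" "gram b q * (s * t) = 0" using e by linarith+
    then show ?thesis using that(4) by auto
  qed
  obtain s t where st: "s \<noteq> 0" "t \<noteq> 0"
    "\<And>b. b \<in> B \<Longrightarrow> gram b j * s + gram b k * t = (if b = j then s else if b = k then t else 0)"
    using pair_relation[OF psd jk] by blast
  have jeq: "gram j j * s + gram j k * t = s" using st(3)[OF jk(1)] by simp
  consider "s * t < 0" | "s * t > 0" using st by (metis linorder_neqE_linordered_idom no_zero_divisors)
  then show ?thesis
  proof cases
    case 1
    then show ?thesis using mixed[OF jk(1,2) _ jeq] by blast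
  next
    case 2
    obtain s' t' where st': "s' \<noteq> 0" "t' \<noteq> 0"
      "\<And>b. b \<in> B \<Longrightarrow> gram b j * s' + gram b l * t' = (if b = j then s' else if b = l then t' else 0)"
      using pair_relation[OF psd jk(1) l(1)] l by metis
    consider "s' * t' < 0" | "s' * t' > 0" using st' by (metis linorder_neqE_linordered_idom no_zero_divisors)
    then show ?thesis
    proof cases
      case 1
      have "gram j j * s' + gram j l * t' = s'" using st'(3)[OF jk(1)] by simp
      then have "gram j j = 1" using mixed[OF jk(1) l(1) 1] by blast
      then show ?thesis using jeq st by simp
    next
      case 2
      have "gram k j * s' + gram k l * t' = 0" using st'(3)[OF jk(2)] jk(3) l by simp
      then have "gram k j = 0" using same[OF jk(1) l(1) jk(2) 2] by blast
      then show ?thesis by (simp add: gram_commute)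
    qed
  qed
qed

lemma columns_unit:
  assumes psd: semidefinite and j: "j \<in> B"
  shows "gram j j = 1"
proof -
  have "card (B - {j}) > 0" using fin card m3 j by simp
  then obtain k where k: "k \<in> B" "j \<noteq> k" by (auto simp: card_gt_0_iff)
  obtain s t where st: "s \<noteq> 0" "t \<noteq> 0"
    "\<And>b. b \<in> B \<Longrightarrow> gram b j * s + gram b k * t = (if b = j then s else if b = k then t else 0)"
    using pair_relation[OF psd j k] by blast
  show ?thesis using st(3)[OF j] columns_orthogonal[OF psd j k] st(1) by simp
qed

text \<open>
  By the previous lemmas and their mirror images, rows and columns of the matrix of slacks are orthonormal.
  As the entries are nonnegative, a row then has a single nonzero entry, which is 1; but all slacks are
  less than 1.
\<close>

lemma not_semidefinite: "\<not> semidefinite"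
proof
  assume psd: semidefinite
  then have psd': "disjoint_simplices.semidefinite B A" by (simp add: Un_commute)
  obtain j where j: "j \<in> B" using card m3 by (metis card.empty ex_in_conv not_numeral_le_zero)
  have "\<exists>a\<in>A. slack a j \<noteq> 0"
  proof (rule ccontr)
    assume "\<not> ?thesis"
    then have "gram j j = 0" by (simp add: gram_def)
    then show False using columns_unit[OF psd j] by simp
  qed
  then obtain a where a: "a \<in> A" "slack a j \<noteq> 0" by blast
  have "slack a b = 0" if "b \<in> B - {j}" for b
  proof -
    have "(\<Sum>a\<in>A. slack a j * slack a b) = 0"
      using columns_orthogonal[OF psd j] that by (auto simp: gram_def)
    moreover have "0 \<le> slack a j * slack a b" if "a \<in> A" for a
      using slack_nonneg[OF that] \<open>b \<in> B - {j}\<close> j by simp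
    ultimately have "slack a j * slack a b = 0"
      using sum_nonneg_eq_0_iff[OF fin(1), of "\<lambda>a. slack a j * slack a b"] a by blast
    then show ?thesis using a by simp
  qed
  then have "(\<Sum>b\<in>B. slack a b * slack a b) = (\<Sum>b\<in>{j}. slack a b * slack a b)"
    using fin j by (intro sum.mono_neutral_right) auto
  also have "\<dots> = slack a j * slack a j" by simp
  finally have "(\<Sum>b\<in>B. slack b a * slack b a) = slack a j * slack a j"
    by (simp only: slack_commute[of _ a])
  moreover have "(\<Sum>b\<in>B. slack b a * slack b a) = 1"
    using disjoint_simplices.columns_unit[OF swap psd' a(1)]
    by (simp only: disjoint_simplices.gram_def[OF swap])
  moreover have "slack a j * slack a j \<le> slack a j * 1"
    using slack_nonneg[OF a(1) j] slack_less_1[OF a(1) j] by (intro mult_left_mono) linarith+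
  ultimately show False using slack_less_1[OF a(1) j] by linarith
qed

text \<open>
  A radical vector of nonzero height could be used to shift a timelike vector to height 0, where the form
  is nonnegative.
\<close>

lemma height_radical:
  assumes rad: "\<And>v. v \<in> A \<union> B \<Longrightarrow> lform (comb x y) (lift v) = 0"
  shows "sum x A = sum y B"
proof -
  define z where "z = comb x y"
  have zero: "lform z (comb x' y') = 0" for x' y'
    unfolding comb_def lform_diff_right lform_sum_right using rad by (simp add: z_def)
  obtain x' y' where neg: "lform (comb x' y') (comb x' y') < 0"
    using not_semidefinite unfolding semidefinite_iff by (auto simp: not_le)
  define w where "w = comb x' y'"
  have zw: "lform z w = 0" "lform z z = 0" using zero by (auto simp: w_def z_def)
  have "height z = 0"
  proof (rule ccontr)
    assume h: "height z \<noteq> 0"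
    \<comment> \<open>The multiple of \<open>z\<close> is chosen to cancel the height; as \<open>z\<close> is radical, the square stays negative.\<close>
    define u where "u = w - (height w / height z) *\<^sub>R z"
    have "height u = 0" using h by (simp add: u_def height_simps)
    then have "0 \<le> lform u u" using lform_height_0[of u] by simp
    moreover have "lform u u = lform w w"
      by (simp add: u_def lform_simps zw lform_commute[of w z])
    ultimately show False using neg by (simp add: w_def)
  qed
  then show ?thesis by (simp add: z_def height_comb)
qed

end

text \<open>
  Splitting off such a relation leaves a block of the matrix of slacks without nonnegative relations. The
  relation is 0 if there is no other nonnegative one.
\<close>

locale maximal_relation = disjoint_simplices +
  fixes x0 y0
  assumes rel0: "comb x0 y0 = 0"
    and nonneg0: "\<And>a. a \<in> A \<Longrightarrow> 0 \<le> x0 a" "\<And>b. b \<in> B \<Longrightarrow> 0 \<le> y0 b"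
    and max0: "\<And>x y. comb x y = 0 \<Longrightarrow> \<forall>a\<in>A. 0 \<le> x a \<Longrightarrow> \<forall>b\<in>B. 0 \<le> y b \<Longrightarrow>
      (\<forall>a\<in>A. 0 < x a \<longrightarrow> 0 < x0 a) \<and> (\<forall>b\<in>B. 0 < y b \<longrightarrow> 0 < y0 b)"
begin

definition I :: "'a set" where "I = {a\<in>A. 0 < x0 a}"

definition J :: "'a set" where "J = {b\<in>B. 0 < y0 b}"

lemma IJ_sub: "I \<subseteq> A" "J \<subseteq> B" by (auto simp: I_def J_def)

lemma x0_0: "a \<in> A - I \<Longrightarrow> x0 a = 0" and y0_0: "b \<in> B - J \<Longrightarrow> y0 b = 0"
  using nonneg0 by (force simp: I_def J_def)+

lemma swap_max: "maximal_relation B A m y0 x0"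
proof -
  interpret sw: disjoint_simplices B A m by (rule swap)
  show ?thesis
  proof
    show "sw.comb y0 x0 = 0" using rel0 by (simp add: comb_swap)
    show "(\<forall>a\<in>B. 0 < x a \<longrightarrow> 0 < y0 a) \<and> (\<forall>b\<in>A. 0 < y b \<longrightarrow> 0 < x0 b)"
      if "sw.comb x y = 0" "\<forall>a\<in>B. 0 \<le> x a" "\<forall>b\<in>A. 0 \<le> y b" for x y
      using max0[of y x] that by (simp add: comb_swap)
  qed (use nonneg0 in auto)
qed

lemma swap_IJ: "maximal_relation.I B y0 = J" "maximal_relation.J A x0 = I"
  by (simp_all add: I_def J_def maximal_relation.I_def[OF swap_max] maximal_relation.J_def[OF swap_max])

text \<open>
  The support of the maximal relation splits the matrix of slacks into two diagonal blocks: for \<open>a\<close>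
  outside of \<open>I\<close>, the value \<open>x0 a = 0\<close> is a sum of nonnegative terms.
\<close>

lemma block_0: "a \<in> A - I \<Longrightarrow> b \<in> J \<Longrightarrow> slack a b = 0"
proof -
  assume a: "a \<in> A - I" and b: "b \<in> J"
  have "(\<Sum>b\<in>B. slack a b * y0 b) = 0" using relation_eqs(1)[OF rel0, of a] x0_0[OF a] a by simp
  moreover have "0 \<le> slack a b * y0 b" if "b \<in> B" for b
    using slack_nonneg[of a b] nonneg0(2)[OF that] a that by simp
  ultimately have "slack a b * y0 b = 0"
    using sum_nonneg_eq_0_iff[OF fin(2), of "\<lambda>b. slack a b * y0 b"] b IJ_sub by blast
  then show ?thesis using b by (simp add: J_def)
qed

lemma block_0': "a \<in> I \<Longrightarrow> b \<in> B - J \<Longrightarrow> slack a b = 0"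
  using maximal_relation.block_0[OF swap_max, of b a] by (simp add: swap_IJ slack_commute)

text \<open>
  The relations that live on the second diagonal block. By maximality none of them is nonnegative, apart
  from 0, so the excess argument applies to them without exception.
\<close>

definition free :: "('a \<Rightarrow> real) \<Rightarrow> ('a \<Rightarrow> real) \<Rightarrow> bool" where
  "free x y \<longleftrightarrow> comb x y = 0 \<and> (\<forall>a\<in>I. x a = 0) \<and> (\<forall>b\<in>J. y b = 0)"

lemma free_if_J:
  assumes "comb x y = 0" and "\<And>b. b \<in> J \<Longrightarrow> y b = 0"
  shows "free x y"
proof -
  have "x a = 0" if "a \<in> I" for a
  proof -
    have "slack a b * y b = 0" if "b \<in> B" for b
      using assms(2)[of b] block_0'[OF \<open>a \<in> I\<close>, of b] that by (cases "b \<in> J") auto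
    then have "(\<Sum>b\<in>B. slack a b * y b) = 0" by (intro sum.neutral) blast
    then show ?thesis using relation_eqs(1)[OF assms(1), of a] that IJ_sub by auto
  qed
  then show ?thesis using assms by (simp add: free_def)
qed

lemma free_swap: "maximal_relation.free B A y0 x0 y x \<longleftrightarrow> free x y"
  by (auto simp: free_def maximal_relation.free_def[OF swap_max] swap_IJ comb_swap)

lemma free_nonneg:
  assumes f: "free x y" and nn: "\<forall>a\<in>A. 0 \<le> x a" "\<forall>b\<in>B. 0 \<le> y b"
  shows "(\<forall>a\<in>A. x a = 0) \<and> (\<forall>b\<in>B. y b = 0)"
proof -
  have *: "\<forall>a\<in>A. 0 < x a \<longrightarrow> 0 < x0 a" "\<forall>b\<in>B. 0 < y b \<longrightarrow> 0 < y0 b"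
    using max0[OF _ nn] f by (auto simp: free_def)
  have "x a = 0" if a: "a \<in> A" for a
  proof (rule ccontr)
    assume ne: "x a \<noteq> 0"
    then have "0 < x a" using nn(1) a by force
    then have "a \<in> I" using *(1) a by (simp add: I_def)
    then show False using f ne by (simp add: free_def)
  qed
  moreover have "y b = 0" if b: "b \<in> B" for b
  proof (rule ccontr)
    assume ne: "y b \<noteq> 0"
    then have "0 < y b" using nn(2) b by force
    then have "b \<in> J" using *(2) b by (simp add: J_def)
    then show False using f ne by (simp add: free_def)
  qed
  ultimately show ?thesis by blast
qed

lemma free_minus: "free x y \<Longrightarrow> free (\<lambda>a. - x a) (\<lambda>b. - y b)"
  by (simp add: free_def comb_minus)

lemma free_nonpos:
  assumes f: "free x y" and "\<forall>a\<in>A. x a \<le> 0" "\<forall>b\<in>B. y b \<le> 0"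
  shows "(\<forall>a\<in>A. x a = 0) \<and> (\<forall>b\<in>B. y b = 0)"
  using free_nonneg[OF free_minus[OF f]] assms by simp

lemma free_excess_0:
  assumes f: "free x y" and e: "excess x y = 0"
  shows "(\<forall>a\<in>A. x a = 0) \<and> (\<forall>b\<in>B. y b = 0)"
proof -
  have "comb (pos x) (pos y) = 0" using f e by (intro comb_pos_zero) (auto simp: free_def excess_def)
  then have "free (pos x) (pos y)" using f by (simp add: free_def)
  from free_nonneg[OF this] have "(\<forall>a\<in>A. pos x a = 0) \<and> (\<forall>b\<in>B. pos y b = 0)" by simp
  then have "\<forall>a\<in>A. x a \<le> 0" "\<forall>b\<in>B. y b \<le> 0" by (metis max.cobounded1)+
  then show ?thesis by (rule free_nonpos[OF f])
qed

lemma ex_free_small: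
  assumes f: "free x y" and nz: "\<not> ((\<forall>a\<in>A. x a = 0) \<and> (\<forall>b\<in>B. y b = 0))"
  shows "\<exists>x y. free x y \<and> \<not> ((\<forall>a\<in>A. x a = 0) \<and> (\<forall>b\<in>B. y b = 0)) \<and> card {b\<in>B. y b \<noteq> 0} \<le> 3"
proof (cases "card (B - J) \<le> 3")
  case True
  have "{b\<in>B. y b \<noteq> 0} \<subseteq> B - J" using f by (auto simp: free_def)
  then have "card {b\<in>B. y b \<noteq> 0} \<le> card (B - J)" using fin by (intro card_mono) auto
  then show ?thesis using True assms by (intro exI[of _ x] exI[of _ y]) linarith
next
  case False
  then have "3 \<le> card (B - J)" by simp
    then obtain T where T: "T \<subseteq> B - J" "card T = 3"
      by (rule obtain_subset_with_card_n)
  have TB: "T \<subseteq> B" using T by auto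
  have "card (A \<union> T) = card A + card T"
    using fin disj TB finite_subset[OF TB] by (intro card_Un_disjoint) auto
  then have "dependent (lift ` (A \<union> T))" using T TB card by (intro dep) auto
  from ex_relation[OF order_refl TB this] obtain x y where rel: "comb x y = 0"
    and y0: "\<forall>b\<in>B - T. y b = 0" and nz: "\<not> ((\<forall>a\<in>A. x a = 0) \<and> (\<forall>b\<in>B. y b = 0))"
    by blast
  have "free x y" using rel y0 T IJ_sub by (intro free_if_J) auto
  moreover have "card {b\<in>B. y b \<noteq> 0} \<le> 3"
    using card_mono[OF finite_subset[OF TB fin(2)], of "{b\<in>B. y b \<noteq> 0}"] y0 T by auto
  ultimately show ?thesis using nz by blast
qed

text \<open>
  The excess is positive at a free relation with small support in \<open>B\<close> and negative at one with small
  support in \<open>A\<close>. Along the segment between them it vanishes somewhere, hence at the zero relation;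
  but then the two relations are negative multiples of each other and their excesses have the same sign.
\<close>

lemma free_trivial:
  assumes f: "free x y"
  shows "(\<forall>a\<in>A. x a = 0) \<and> (\<forall>b\<in>B. y b = 0)"
proof (rule ccontr)
  assume nz: "\<not> ?thesis"
  obtain x1 y1 where f1: "free x1 y1" "\<not> ((\<forall>a\<in>A. x1 a = 0) \<and> (\<forall>b\<in>B. y1 b = 0))"
    "card {b\<in>B. y1 b \<noteq> 0} \<le> 3"
    using ex_free_small[OF f nz] by blast
  have fs: "maximal_relation.free B A y0 x0 y x" using f by (simp add: free_swap)
  have nz': "\<not> ((\<forall>b\<in>B. y b = 0) \<and> (\<forall>a\<in>A. x a = 0))" using nz by blast
  obtain x2 y2 where f2: "free x2 y2" "\<not> ((\<forall>a\<in>A. x2 a = 0) \<and> (\<forall>b\<in>B. y2 b = 0))"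
    "card {a\<in>A. x2 a \<noteq> 0} \<le> 3"
    using maximal_relation.ex_free_small[OF swap_max fs nz'] unfolding free_swap by auto
  have pos1: "excess x1 y1 > 0"
  proof (rule excess_pos[OF _ f1(3)])
    show "comb x1 y1 = 0" using f1(1) by (simp add: free_def)
    show "\<not> ((\<forall>a\<in>A. x1 a \<le> 0) \<and> (\<forall>b\<in>B. y1 b \<le> 0))" using free_nonpos[OF f1(1)] f1(2) by blast
    show "\<not> ((\<forall>a\<in>A. x1 a \<ge> 0) \<and> (\<forall>b\<in>B. y1 b \<ge> 0))" using free_nonneg[OF f1(1)] f1(2) by blast
  qed
  have neg2: "excess x2 y2 < 0"
  proof (rule excess_neg[OF _ f2(3)])
    show "comb x2 y2 = 0" using f2(1) by (simp add: free_def)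
    show "\<not> ((\<forall>a\<in>A. x2 a \<le> 0) \<and> (\<forall>b\<in>B. y2 b \<le> 0))" using free_nonpos[OF f2(1)] f2(2) by blast
    show "\<not> ((\<forall>a\<in>A. x2 a \<ge> 0) \<and> (\<forall>b\<in>B. y2 b \<ge> 0))" using free_nonneg[OF f2(1)] f2(2) by blast
  qed
  define xt where "xt = (\<lambda>t a. (1 - t) * x1 a + t * x2 a)"
  define yt where "yt = (\<lambda>t b. (1 - t) * y1 b + t * y2 b)"
  have free_t: "free (xt t) (yt t)" for t
  proof -
    have "comb (xt t) (yt t) = (1 - t) *\<^sub>R comb x1 y1 + t *\<^sub>R comb x2 y2"
      unfolding xt_def yt_def by (simp add: comb_add comb_scale)
    then show ?thesis using f1(1) f2(1) by (simp add: free_def xt_def yt_def)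
  qed
  have "continuous_on {0..1} (\<lambda>t. excess (xt t) (yt t))"
    unfolding excess_def xt_def yt_def by (intro continuous_intros)
  moreover have "excess (xt 0) (yt 0) = excess x1 y1" "excess (xt 1) (yt 1) = excess x2 y2"
    by (simp_all add: xt_def yt_def)
  ultimately obtain t where t: "0 \<le> t" "t \<le> 1" "excess (xt t) (yt t) = 0"
    using IVT2'[of "\<lambda>t. excess (xt t) (yt t)" 1 0 0] pos1 neg2 by auto
  have zero: "(\<forall>a\<in>A. xt t a = 0) \<and> (\<forall>b\<in>B. yt t b = 0)" by (rule free_excess_0[OF free_t t(3)])
  have "(1 - t) * x1 a = t * - x2 a" if "a \<in> A" for a
    using zero that by (simp add: xt_def add_eq_0_iff2)
  moreover have "(1 - t) * y1 b = t * - y2 b" if "b \<in> B" for b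
    using zero that by (simp add: yt_def add_eq_0_iff2)
  ultimately have e12: "excess (\<lambda>a. (1 - t) * x1 a) (\<lambda>b. (1 - t) * y1 b) = excess (\<lambda>a. t * - x2 a) (\<lambda>b. t * - y2 b)"
    unfolding excess_def by (intro arg_cong2[of _ _ _ _ "(-)"] sum.cong) auto
  have e1: "excess (\<lambda>a. (1 - t) * x1 a) (\<lambda>b. (1 - t) * y1 b) = (1 - t) * excess x1 y1"
    using t by (intro excess_scale) linarith
  have e2: "excess (\<lambda>a. t * - x2 a) (\<lambda>b. t * - y2 b) = t * excess (\<lambda>a. - x2 a) (\<lambda>b. - y2 b)"
    by (rule excess_scale[OF t(1)])
  have "(1 - t) * excess x1 y1 = t * excess (\<lambda>a. - x2 a) (\<lambda>b. - y2 b)"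
    using e12 unfolding e1 e2 .
  also have "excess (\<lambda>a. - x2 a) (\<lambda>b. - y2 b) = excess x2 y2"
    using f2(1) by (intro excess_minus) (simp add: free_def)
  finally have "(1 - t) * excess x1 y1 = t * excess x2 y2" .
  moreover have "0 \<le> (1 - t) * excess x1 y1" "t * excess x2 y2 \<le> 0"
    using t pos1 neg2 by (auto simp: mult_nonneg_nonpos)
  ultimately have "(1 - t) * excess x1 y1 = 0" "t * excess x2 y2 = 0" by linarith+
  then show False using pos1 neg2 by simp
qed

text \<open>
  As there are no free relations, the dependence of \<open>m + 3\<close> lifts leaves at most two vertices of \<open>B\<close>
  outside of \<open>J\<close>. If there were exactly two, then together with any \<open>j \<in> J\<close> they would carry a relation
  whose restriction to the first block is supported by the single vertex \<open>j\<close> of \<open>B\<close>. The restriction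
  is a radical vector, so it has height 0, and column \<open>j\<close> would have sum and sum of squares equal to 1.
\<close>

lemma card_B_J_le_1: "card (B - J) \<le> 1"
proof -
  have finJ: "finite J" "finite (B - J)" using fin finite_subset[OF IJ_sub(2)] by auto
  have nontriv: False
    if T: "T \<subseteq> B" "card T = 3" "\<And>x y. comb x y = 0 \<Longrightarrow> \<forall>b\<in>B - T. y b = 0 \<Longrightarrow> free x y" for T
  proof -
    have "card (A \<union> T) = card A + card T"
      using fin disj T finite_subset[OF T(1)] by (intro card_Un_disjoint) auto
    then have "dependent (lift ` (A \<union> T))" using T card by (intro dep) auto
    from ex_relation[OF order_refl T(1) this] obtain x y where "comb x y = 0" "\<forall>b\<in>B - T. y b = 0"
      "\<not> ((\<forall>a\<in>A. x a = 0) \<and> (\<forall>b\<in>B. y b = 0))" by blast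
    then show False using free_trivial[OF T(3), of x y] by simp
  qed
  have le2: "card (B - J) \<le> 2"
  proof (rule ccontr)
    assume "\<not> ?thesis"
    then have "3 \<le> card (B - J)" by simp
      then obtain T where T: "T \<subseteq> B - J" "card T = 3"
        by (rule obtain_subset_with_card_n)
    show False
    proof (rule nontriv[of T])
      show "free x y" if "comb x y = 0" "\<forall>b\<in>B - T. y b = 0" for x y
        using that T IJ_sub by (intro free_if_J) auto
    qed (use T in auto)
  qed
  have "card (B - J) \<noteq> 2"
  proof
    assume c2: "card (B - J) = 2"
    have "card J > 0" using c2 card(2) m3 card_Diff_subset[OF finJ(1) IJ_sub(2)] by simp
    then obtain j where j: "j \<in> J" by (auto simp: card_gt_0_iff)
    have jB: "j \<in> B" using j IJ_sub by auto
    show False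
    proof (rule nontriv[of "insert j (B - J)"])
      show "insert j (B - J) \<subseteq> B" using jB by auto
      show "card (insert j (B - J)) = 3" using c2 finJ j by simp
      fix x y assume rel: "comb x y = 0" and "\<forall>b\<in>B - insert j (B - J). y b = 0"
      then have yJ: "y b = 0" if "b \<in> J" "b \<noteq> j" for b using that IJ_sub by auto
      note eqs = relation_eqs[OF rel]
      show "free x y"
      proof (rule free_if_J[OF rel])
        fix b assume b: "b \<in> J"
        have "y j = 0"
        proof (rule ccontr)
          assume yj: "y j \<noteq> 0"
          \<comment> \<open>The restriction of the relation to the first block \<open>I \<times> J\<close>.\<close>
          define x' where "x' a = (if a \<in> I then x a else 0)" for a
          define y' where "y' b = (if b = j then y j else 0)" for b
          have y'sum: "(\<Sum>b\<in>B. f b * y' b) = f j * y j" for f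
          proof -
            have "(\<Sum>b\<in>B. f b * y' b) = (\<Sum>b\<in>B. if b = j then f j * y j else 0)"
              by (intro sum.cong) (auto simp: y'_def)
            then show ?thesis using fin jB by simp
          qed
          have xI: "x a = slack a j * y j" if "a \<in> I" for a
          proof -
            have "slack a b * y b = slack a b * y' b" if "b \<in> B" for b
              using block_0'[OF \<open>a \<in> I\<close>, of b] yJ[of b] that by (cases "b \<in> J") (auto simp: y'_def)
            then have "(\<Sum>b\<in>B. slack a b * y b) = (\<Sum>b\<in>B. slack a b * y' b)" by (intro sum.cong) auto
            then show ?thesis using eqs(1)[of a] that IJ_sub y'sum by auto
          qed
          have x': "x' a = slack a j * y j" if "a \<in> A" for a
            using xI[of a] block_0[of a j] j that by (auto simp: x'_def)
          have yb: "(\<Sum>a\<in>A. slack a b * x' a) = y' b" if "b \<in> B" for b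
          proof (cases "b \<in> J")
            case True
            then have "slack a b * x' a = slack a b * x a" if "a \<in> A" for a
              using block_0[of a b] that by (auto simp: x'_def)
            then have "(\<Sum>a\<in>A. slack a b * x' a) = (\<Sum>a\<in>A. slack a b * x a)" by (intro sum.cong) blast+
            then have "(\<Sum>a\<in>A. slack a b * x' a) = y b" using eqs(2)[OF that] by linarith
            then show ?thesis using yJ[OF True] by (simp add: y'_def)
          next
            case False
            then have "slack a b * x' a = 0" for a
              using block_0'[of a b] that by (auto simp: x'_def)
            then have "(\<Sum>a\<in>A. slack a b * x' a) = 0" by (intro sum.neutral) blast
            then show ?thesis using False j by (auto simp: y'_def)
          qed
          have "sum x' A = sum y' B"
          proof (rule height_radical)
            fix v assume "v \<in> A \<union> B"
            then show "lform (comb x' y') (lift v) = 0"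
            proof
              assume "v \<in> A" then show ?thesis by (simp add: lform_comb_A y'sum x')
            next
              assume "v \<in> B" then show ?thesis using yb by (simp add: lform_comb_B)
            qed
          qed
          then have "y j * (\<Sum>a\<in>A. slack a j) = y j * 1"
            using y'sum[of "\<lambda>_. 1"] by (simp add: x' sum_distrib_left mult.commute)
          then have s1: "(\<Sum>a\<in>A. slack a j) = 1" using yj by simp
          have "y j * (\<Sum>a\<in>A. (slack a j)\<^sup>2) = y j * 1"
            using yb[OF jB] by (simp add: x' y'_def sum_distrib_left power2_eq_square mult_ac)
          then have "(\<Sum>a\<in>A. (slack a j)\<^sup>2) = 1" using yj by simp
          moreover have "(\<Sum>a\<in>A. (slack a j)\<^sup>2) < 1"
            using fin s1 slack_nonneg[OF _ jB] slack_less_1[OF _ jB] by (intro sum_squares_less_sum) auto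
          ultimately show False by simp
        qed
        then show "y b = 0" using yJ[OF b] by auto
      qed
    qed
  qed
  then show ?thesis using le2 by linarith
qed

lemma weight_bound:
  assumes "a \<in> A"
  shows "(\<Sum>b\<in>B. slack a b * (if b \<in> J then y0 b else 1)) \<le> (if a \<in> I then x0 a else 1)"
proof (cases "a \<in> I")
  case True
  have "slack a b * (if b \<in> J then y0 b else 1) = slack a b * y0 b" if "b \<in> B" for b
    using block_0'[OF True, of b] that by auto
  then have "(\<Sum>b\<in>B. slack a b * (if b \<in> J then y0 b else 1)) = (\<Sum>b\<in>B. slack a b * y0 b)"
    by (intro sum.cong) blast+
  then have "(\<Sum>b\<in>B. slack a b * (if b \<in> J then y0 b else 1)) = x0 a"
    using relation_eqs(1)[OF rel0 assms] by linarith
  then show ?thesis using True by simp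
next
  case False
  have "(\<Sum>b\<in>B. slack a b * (if b \<in> J then y0 b else 1)) = (\<Sum>b\<in>B - J. slack a b * 1)"
    using block_0[of a] False assms fin by (intro sum.mono_neutral_cong_right) auto
  also have "\<dots> \<le> (\<Sum>b\<in>B - J. 1)"
    using slack_less_1[OF assms] by (intro sum_mono) (auto simp: less_imp_le)
  also have "\<dots> \<le> 1" using card_B_J_le_1 by simp
  finally show ?thesis using False by simp
qed

text \<open>
  The second block has at most one row and one column, and its entry is less than 1. Hence the maximal
  relation, extended by 1 on the second block, is a system of weights that proves semidefiniteness.
\<close>

lemma inconsistent: False
proof -
  have semidefinite
  proof (rule semidefinite_if_weights)
    show "(if a \<in> I then x0 a else 1) > 0" for a by (simp add: I_def)
    show "(if b \<in> J then y0 b else 1) > 0" for b by (simp add: J_def)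
    show "(\<Sum>b\<in>B. slack a b * (if b \<in> J then y0 b else 1)) \<le> (if a \<in> I then x0 a else 1)"
      if "a \<in> A" for a by (rule weight_bound[OF that])
    show "(\<Sum>a\<in>A. slack a b * (if a \<in> I then x0 a else 1)) \<le> (if b \<in> J then y0 b else 1)"
      if "b \<in> B" for b
      using maximal_relation.weight_bound[OF swap_max that] by (simp add: swap_IJ slack_commute)
  qed
  then show False using not_semidefinite by blast
qed

end

text \<open>
  A nonnegative relation with a support of maximal size dominates the support of every other one, because
  the sum of two nonnegative relations is nonnegative and supported by the union.
\<close>

theorem (in disjoint_simplices) impossible: False
proof -
  define P where "P = (\<lambda>(x, y). comb x y = 0 \<and> (\<forall>a\<in>A. 0 \<le> x a) \<and> (\<forall>b\<in>B. 0 \<le> y b))"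
  define n where "n = (\<lambda>(x :: 'a \<Rightarrow> real, y :: 'a \<Rightarrow> real). card {a\<in>A. 0 < x a} + card {b\<in>B. 0 < y b})"
  have bound: "n p < 2 * m + 1" for p
  proof -
    have "card {a\<in>A. 0 < fst p a} \<le> card A" "card {b\<in>B. 0 < snd p b} \<le> card B"
      using fin by (auto intro!: card_mono)
    then show ?thesis by (simp add: n_def card case_prod_beta)
  qed
  have "P (\<lambda>_. 0, \<lambda>_. 0)" by (simp add: P_def comb_def)
  from ex_has_greatest_nat[of P, OF this, of n "2 * m + 1"] bound
  obtain p where p: "P p" "\<And>q. P q \<Longrightarrow> n q \<le> n p" by (metis less_imp_le)
  obtain x0 y0 where xy: "p = (x0, y0)" by (cases p)
  have p0: "comb x0 y0 = 0" "\<forall>a\<in>A. 0 \<le> x0 a" "\<forall>b\<in>B. 0 \<le> y0 b" using p(1) by (auto simp: P_def xy)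
  have "maximal_relation A B m x0 y0"
  proof (unfold_locales, goal_cases)
    case (4 x y)
    define x1 y1 where "x1 = (\<lambda>a. x0 a + x a)" and "y1 = (\<lambda>b. y0 b + y b)"
    have "comb x1 y1 = 0" using p0 4 by (simp add: x1_def y1_def comb_add)
    then have "P (x1, y1)" using p0 4 by (auto simp: P_def x1_def y1_def)
    then have le: "n (x1, y1) \<le> n (x0, y0)" using p(2) xy by blast
    have sub: "{a\<in>A. 0 < x0 a} \<subseteq> {a\<in>A. 0 < x1 a}" "{b\<in>B. 0 < y0 b} \<subseteq> {b\<in>B. 0 < y1 b}"
      using 4 by (auto simp: x1_def y1_def intro: add_pos_nonneg)
    have f: "finite {a\<in>A. 0 < x1 a}" "finite {b\<in>B. 0 < y1 b}" using fin by auto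
    have "card {a\<in>A. 0 < x0 a} \<le> card {a\<in>A. 0 < x1 a}" "card {b\<in>B. 0 < y0 b} \<le> card {b\<in>B. 0 < y1 b}"
      using sub f by (auto intro: card_mono)
    then have "card {a\<in>A. 0 < x0 a} = card {a\<in>A. 0 < x1 a}" "card {b\<in>B. 0 < y0 b} = card {b\<in>B. 0 < y1 b}"
      using le by (auto simp: n_def)
    then have eq: "{a\<in>A. 0 < x0 a} = {a\<in>A. 0 < x1 a}" "{b\<in>B. 0 < y0 b} = {b\<in>B. 0 < y1 b}"
      using card_subset_eq[OF f(1) sub(1)] card_subset_eq[OF f(2) sub(2)] by auto
    have "0 < x0 a" if "a \<in> A" "0 < x a" for a
    proof -
      have "a \<in> {a\<in>A. 0 < x1 a}" using that p0(2) by (auto simp: x1_def intro: add_nonneg_pos)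
      then show ?thesis using eq(1) by blast
    qed
    moreover have "0 < y0 b" if "b \<in> B" "0 < y b" for b
    proof -
      have "b \<in> {b\<in>B. 0 < y1 b}" using that p0(3) by (auto simp: y1_def intro: add_nonneg_pos)
      then show ?thesis using eq(2) by blast
    qed
    ultimately show ?case by blast
  qed (use p0 in auto)
  then show False by (rule maximal_relation.inconsistent)
qed

section \<open>Two cliques of size d share d - 2 vertices\<close>

definition unit_clique :: "'a::metric_space set \<Rightarrow> bool" where
  "unit_clique K \<longleftrightarrow> (\<forall>x\<in>K. \<forall>y\<in>K. x \<noteq> y \<longrightarrow> dist x y = 1)"

lemma unit_cliqueD: "unit_clique K \<Longrightarrow> x \<in> K \<Longrightarrow> y \<in> K \<Longrightarrow> x \<noteq> y \<Longrightarrow> dist x y = 1"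
  by (auto simp: unit_clique_def)

lemma unit_clique_subset: "unit_clique K \<Longrightarrow> L \<subseteq> K \<Longrightarrow> unit_clique L"
  by (auto simp: unit_clique_def)

text \<open>
  The common setting of Euclidean space and of large spheres. The vector \<open>n\<close> represents the height on \<open>U\<close>.
  Its square \<open>lform n n\<close> is its height, so the last assumption says that \<open>n\<close> is not spacelike; with
  \<open>lform_height_0\<close> this makes \<open>U\<close> Lorentzian as soon as it contains a lift.
\<close>

locale diameter_model =
  fixes V :: "'a::euclidean_space set" and U :: "('a \<times> real \<times> real) set"
    and n :: "'a \<times> real \<times> real" and d :: nat
  assumes finV: "finite V" and dist_le_1: "\<And>x y. x \<in> V \<Longrightarrow> y \<in> V \<Longrightarrow> dist x y \<le> 1"
    and subU: "subspace U" and dimU: "dim U \<le> d + 2" and liftU: "\<And>x. x \<in> V \<Longrightarrow> lift x \<in> U"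
    and nU: "n \<in> U" and lform_n: "\<And>u. u \<in> U \<Longrightarrow> lform n u = height u" and height_n: "height n \<le> 0"
begin

lemma slack_ge_0: "x \<in> V \<Longrightarrow> y \<in> V \<Longrightarrow> 0 \<le> slack x y"
  using dist_le_1[of x y] by (simp add: slack_def power_le_one)

lemma lform_sum_clique:
  assumes "finite S" "unit_clique S" "s \<in> S"
  shows "lform (\<Sum>v\<in>S. f v *\<^sub>R lift v) (lift s) = f s"
proof -
  have "lform (\<Sum>v\<in>S. f v *\<^sub>R lift v) (lift s) = (\<Sum>v\<in>S. if v = s then f s else 0)"
    unfolding lform_sum_left lform_lift
    using assms by (intro sum.cong) (auto simp: slack_def unit_clique_def)
  then show ?thesis using assms by simp
qed

text \<open>
  The lifts of a clique are orthonormal, so they are independent of everything that is orthogonal to them.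
\<close>

lemma independent_Un_orthogonal:
  assumes W: "W \<subseteq> V" and S: "S \<subseteq> V" "unit_clique S" and WS: "W \<inter> S = {}"
    and orth: "\<And>w s. w \<in> W \<Longrightarrow> s \<in> S \<Longrightarrow> dist w s = 1"
    and ind: "independent (lift ` W)"
  shows "independent (lift ` (W \<union> S))"
proof -
  have fin: "finite W" "finite S" using finite_subset[OF W finV] finite_subset[OF S(1) finV] by auto
  have False
    if f: "\<exists>v\<in>W \<union> S. f v \<noteq> 0" and 0: "(\<Sum>v\<in>W \<union> S. f v *\<^sub>R lift v) = 0" for f
  proof -
    have sum: "(\<Sum>v\<in>W. f v *\<^sub>R lift v) + (\<Sum>v\<in>S. f v *\<^sub>R lift v) = 0"
      using 0 fin WS by (simp add: sum.union_disjoint)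
    have fS: "f s = 0" if s: "s \<in> S" for s
    proof -
      have "lform (\<Sum>v\<in>W. f v *\<^sub>R lift v) (lift s) = 0"
        unfolding lform_sum_left lform_lift using orth s by (intro sum.neutral) (auto simp: slack_def)
      then have "lform ((\<Sum>v\<in>W. f v *\<^sub>R lift v) + (\<Sum>v\<in>S. f v *\<^sub>R lift v)) (lift s) = f s"
        by (simp add: lform_add_left lform_sum_clique[OF fin(2) S(2) s])
      then show ?thesis using sum by simp
    qed
    then have "(\<Sum>v\<in>W. f v *\<^sub>R lift v) = 0" using sum by simp
    moreover have "\<exists>v\<in>W. f v \<noteq> 0" using f fS by blast
    ultimately show False using ind fin dependent_lift_iff by blast
  qed
  then show ?thesis using dependent_lift_iff[of "W \<union> S"] fin by blast
qed

lemma card_lift: "card (lift ` X) = card X"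
  by (rule card_image[OF inj_on_subset[OF inj_lift subset_UNIV]])

lemma dependent_if_orthogonal:
  assumes W: "W \<subseteq> V" and S: "S \<subseteq> V" "unit_clique S" and WS: "W \<inter> S = {}"
    and orth: "\<And>w s. w \<in> W \<Longrightarrow> s \<in> S \<Longrightarrow> dist w s = 1"
    and card: "d + 2 < card W + card S"
  shows "dependent (lift ` W)"
proof (rule ccontr)
  assume ind0: "independent (lift ` W)"
  have ind: "independent (lift ` (W \<union> S))"
    by (rule independent_Un_orthogonal[OF W S WS orth ind0])
  have "card (W \<union> S) = card W + card S"
    using finite_subset[OF W finV] finite_subset[OF S(1) finV] WS by (rule card_Un_disjoint)
  then have "card (lift ` (W \<union> S)) > dim U" unfolding card_lift using card dimU by linarith
  moreover have "lift ` (W \<union> S) \<subseteq> U" using W S liftU by blast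
  then have "card (lift ` (W \<union> S)) \<le> dim U" using ind by (rule independent_card_le_dim)
  ultimately show False by linarith
qed

text \<open>
  If the lifts of \<open>W\<close> were independent, then together with those of \<open>S\<close> they would span \<open>U\<close>, which
  contains the timelike vector \<open>n - lift v / 2\<close>. Removing its component along \<open>S\<close> only decreases the
  square, so the span of \<open>W\<close> would contain a timelike vector as well.
\<close>

lemma dependent_if_orthogonal_semidefinite:
  assumes X: "finite X" "W \<subseteq> X"
    and psd: "\<And>f. 0 \<le> lform (\<Sum>v\<in>X. f v *\<^sub>R lift v) (\<Sum>v\<in>X. f v *\<^sub>R lift v)"
    and W: "W \<subseteq> V" "W \<noteq> {}" and S: "S \<subseteq> V" "unit_clique S" and WS: "W \<inter> S = {}"
    and orth: "\<And>w s. w \<in> W \<Longrightarrow> s \<in> S \<Longrightarrow> dist w s = 1"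
    and card: "d + 2 \<le> card W + card S"
  shows "dependent (lift ` W)"
proof (rule ccontr)
  assume ind0: "independent (lift ` W)"
  have ind: "independent (lift ` (W \<union> S))"
    by (rule independent_Un_orthogonal[OF W(1) S WS orth ind0])
  have fin: "finite W" "finite S" using finite_subset[OF W(1) finV] finite_subset[OF S(1) finV] by auto
  obtain v0 where v0: "v0 \<in> W" using W by auto
  \<comment> \<open>Its square is \<open>height n - 1 + 1/4\<close>; the factor makes it negative even if \<open>height n = 0\<close>.\<close>
  define \<nu> where "\<nu> = n - (1/2) *\<^sub>R lift v0"
  have v0U: "lift v0 \<in> U" using v0 W liftU by auto
  have "\<nu> \<in> U" unfolding \<nu>_def using subU nU v0U by (intro subspace_diff subspace_scale)
  moreover have "U \<subseteq> span (lift ` (W \<union> S))"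
  proof (rule card_ge_dim_independent)
    show "lift ` (W \<union> S) \<subseteq> U" using W S liftU by auto
    have "card (W \<union> S) = card W + card S" using fin WS by (intro card_Un_disjoint) auto
    then show "dim U \<le> card (lift ` (W \<union> S))" unfolding card_lift using card dimU by linarith
  qed (rule ind)
  ultimately have "\<nu> \<in> span (lift ` (W \<union> S))" by blast
  then obtain u where "\<nu> = (\<Sum>v\<in>lift ` (W \<union> S). u v *\<^sub>R v)"
    using fin by (auto simp: real_vector.span_finite)
  also have "\<dots> = (\<Sum>v\<in>W \<union> S. u (lift v) *\<^sub>R lift v)"
    using sum.reindex[OF inj_on_subset[OF inj_lift subset_UNIV], of "\<lambda>v. u v *\<^sub>R v" "W \<union> S"] by simp
  finally have sum: "\<nu> = (\<Sum>v\<in>W \<union> S. u (lift v) *\<^sub>R lift v)" .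
  define f where "f v = u (lift v)" for v
  have \<nu>: "\<nu> = (\<Sum>v\<in>W. f v *\<^sub>R lift v) + (\<Sum>v\<in>S. f v *\<^sub>R lift v)"
    unfolding sum f_def by (rule sum.union_disjoint[OF fin WS])
  define p q where "p = (\<Sum>v\<in>W. f v *\<^sub>R lift v)" and "q = (\<Sum>v\<in>S. f v *\<^sub>R lift v)"
  have "lform p (lift s) = 0" if "s \<in> S" for s
    unfolding p_def lform_sum_left lform_lift using orth that by (intro sum.neutral) (auto simp: slack_def)
  then have pq: "lform p q = 0" unfolding q_def lform_sum_right by simp
  have "lform q (lift s) = f s" if "s \<in> S" for s
    unfolding q_def by (rule lform_sum_clique[OF fin(2) S(2) that])
  moreover have "lform q q = (\<Sum>s\<in>S. f s * lform q (lift s))"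
    by (subst (2) q_def) (rule lform_sum_right)
  ultimately have "lform q q = (\<Sum>s\<in>S. f s * f s)" by simp
  then have qq: "0 \<le> lform q q" by (simp add: sum_nonneg)
  have "p = (\<Sum>v\<in>X. (if v \<in> W then f v else 0) *\<^sub>R lift v)"
    unfolding p_def using X by (intro sum.mono_neutral_cong_left) auto
  then have "0 \<le> lform p p" using psd by simp
  moreover have "lform \<nu> \<nu> = lform p p + lform q q"
    unfolding \<nu> p_def[symmetric] q_def[symmetric]
    by (simp add: lform_simps pq lform_commute[of q p])
  moreover have "lform \<nu> \<nu> = height n - 3/4"
    using lform_n[OF nU] lform_n[OF v0U]
    by (simp add: \<nu>_def lform_simps lform_commute[of "lift v0" n] lform_lift slack_def)
  ultimately show False using qq height_n by linarith
qed

text \<open>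
  The common vertices form a clique whose vertices have distance 1 from all others. Each of them removes one
  dimension, so what remains is a contradictory pair of disjoint simplices if \<open>m \<ge> 3\<close>.
\<close>

theorem cliques_share:
  assumes A: "A \<subseteq> V" "unit_clique A" "card A = d" and B: "B \<subseteq> V" "unit_clique B" "card B = d"
  shows "d \<le> card (A \<inter> B) + 2"
proof (rule ccontr)
  assume neg: "\<not> ?thesis"
  define m where "m = card (A - B)"
  have fin: "finite A" "finite B" using finite_subset[OF A(1) finV] finite_subset[OF B(1) finV] by auto
  have cA: "d = card (A \<inter> B) + m" using card_Int_Diff[OF fin(1), of B] A by (simp add: m_def)
  then have cB: "card (B - A) = m" using card_Int_Diff[OF fin(2), of A] B by (simp add: Int_commute)
  have "disjoint_simplices (A - B) (B - A) m"
  proof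
    show "3 \<le> m" using neg cA by linarith
    show "dist x y \<le> 1" if "x \<in> A - B" "y \<in> B - A" for x y
      using that A B dist_le_1 by blast
    have orth: "dist w s = 1" if "w \<in> W" "s \<in> A \<inter> B" "W \<subseteq> A - B \<union> (B - A)" for w s W
    proof -
      have "w \<noteq> s" using that by auto
      then show ?thesis using unit_cliqueD[OF A(2), of w s] unit_cliqueD[OF B(2), of w s] that by blast
    qed
    have AB: "A \<inter> B \<subseteq> V" "unit_clique (A \<inter> B)" using A unit_clique_subset[OF A(2)] by auto
    show "dependent (lift ` W)" if W: "W \<subseteq> A - B \<union> (B - A)" "m + 3 \<le> card W" for W
      using W A B cA by (intro dependent_if_orthogonal[OF _ AB _ orth]) auto
    show "dependent (lift ` W)"
      if psd: "\<And>f. 0 \<le> lform (\<Sum>v\<in>A - B \<union> (B - A). f v *\<^sub>R lift v) (\<Sum>v\<in>A - B \<union> (B - A). f v *\<^sub>R lift v)"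
        and W: "W \<subseteq> A - B \<union> (B - A)" "m + 2 \<le> card W" for W
    proof (rule dependent_if_orthogonal_semidefinite[OF _ W(1) psd _ _ AB])
      show "W \<noteq> {}" using W(2) by auto
      show "W \<subseteq> V" "W \<inter> (A \<inter> B) = {}" using W(1) A B by auto
      show "finite (A - B \<union> (B - A))" using fin by simp
      show "d + 2 \<le> card W + card (A \<inter> B)" using W(2) cA by linarith
      show "dist w s = 1" if "w \<in> W" "s \<in> A \<inter> B" for w s using orth[OF that W(1)] .
    qed
  qed (use fin cB m_def unit_cliqueD[OF A(2)] unit_cliqueD[OF B(2)] in auto)
  then show False by (rule disjoint_simplices.impossible)
qed

end

section \<open>A vertex that lies in a single clique\<close>

definition unit_cliques :: "nat \<Rightarrow> 'a::metric_space set \<Rightarrow> 'a set set" where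
  "unit_cliques k W = {K. K \<subseteq> W \<and> unit_clique K \<and> card K = k}"

lemma finite_unit_cliques: "finite W \<Longrightarrow> finite (unit_cliques k W)"
  by (rule finite_subset[of _ "Pow W"]) (auto simp: unit_cliques_def)

lemma clique_eq_insert:
  assumes "F \<in> unit_cliques (Suc k) W" "finite W" "T \<subseteq> F" "card T = k"
  obtains u where "u \<in> W - T" "F = insert u T"
proof -
  have F: "F \<subseteq> W" "card F = Suc k" using assms by (auto simp: unit_cliques_def)
  have fF: "finite F" using F(1) assms(2) by (rule finite_subset)
  then have "card (F - T) = 1" using F assms finite_subset[OF assms(3) fF] by (simp add: card_Diff_subset)
  then obtain u where "F - T = {u}" by (rule card_1_singletonE)
  then have "F = insert u T" "u \<in> W - T" using assms(3) F by auto
  then show thesis using that by blast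
qed

context diameter_model begin

text \<open>
  The points of \<open>X\<close> lie on a circle, within an arc shorter than a half circle, and \<open>p\<close> is the one
  between the other two. In the Lorentz space: the three lifts and \<open>N\<close>, which is the component of \<open>n\<close>
  orthogonal to \<open>T\<close>, are dependent because they lie in the orthogonal complement of \<open>T\<close> in \<open>U\<close>,
  whose dimension is at most 3. The relation gives \<open>lift p\<close> as a combination of the two other lifts
  and \<open>N\<close> with nonnegative coefficients, the one of \<open>N\<close> being positive. Multiplying by \<open>lift x\<close> yields
  \<open>slack p x > 0\<close> whenever \<open>lform N (lift x) = 1 - (\<Sum>t\<in>T. slack t x)\<close> is positive.
\<close>

lemma middle_extension:
  assumes T: "T \<subseteq> V" "unit_clique T" "Suc (card T) = d" "T \<noteq> {}"
    and X: "X \<subseteq> V - T" "card X = 3" and XT: "\<And>u t. u \<in> X \<Longrightarrow> t \<in> T \<Longrightarrow> dist u t = 1"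
  shows "\<exists>p\<in>X. \<forall>x\<in>V. (\<Sum>t\<in>T. slack t x) < 1 \<longrightarrow> dist p x \<noteq> 1"
proof -
  have fin: "finite T" "finite X"
    using finite_subset[OF T(1) finV] finite_subset[OF X(1)] finV by auto
  \<comment> \<open>\<open>N\<close> is orthogonal to the lifts of \<open>T\<close>, has product 1 with those of \<open>X\<close>, and is timelike since \<open>T\<close> is
    nonempty. The predicate \<open>R\<close> expresses a relation between \<open>N\<close> and the lifts of \<open>X\<close>.\<close>
  define N where "N = n - (\<Sum>t\<in>T. 1 *\<^sub>R lift t)"
  have nx: "lform n (lift x) = 1" if "x \<in> V" for x using lform_n[OF liftU[OF that]] by simp
  have Nx: "lform N (lift x) = 1 - (\<Sum>t\<in>T. slack t x)" if "x \<in> V" for x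
    unfolding N_def lform_diff_left lform_sum_left nx[OF that] lform_lift by simp
  have sT: "(\<Sum>t\<in>T. slack t x) = 0" if "x \<in> X" for x
    using XT[OF that] by (intro sum.neutral) (simp add: slack_def dist_commute)
  have Nt: "lform N (lift t) = 0" if "t \<in> T" for t
    using lform_sum_clique[OF fin(1) T(2) that, of "\<lambda>_. 1"] nx[of t] that T
    by (auto simp: N_def lform_diff_left)
  have Nn: "lform N n = height n - card T"
  proof -
    have "lform (\<Sum>t\<in>T. 1 *\<^sub>R lift t) n = (\<Sum>t\<in>T. 1)"
      unfolding lform_sum_left using nx T(1) by (intro sum.cong) (auto simp: lform_commute[of _ n])
    then show ?thesis by (simp add: N_def lform_diff_left lform_n[OF nU])
  qed
  have "lform N N = lform N n - (\<Sum>t\<in>T. 1 * lform N (lift t))"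
    by (subst (2) N_def) (simp only: lform_diff_right lform_sum_right)
  then have NN: "lform N N = height n - card T" using Nt Nn by simp
  have "0 < card T" using T(4) fin by (simp add: card_gt_0_iff)
  then have NN_neg: "lform N N < 0" using NN height_n by linarith
  define R where "R f \<mu> \<longleftrightarrow> (\<Sum>u\<in>X. f u *\<^sub>R lift u) + \<mu> *\<^sub>R N = 0 \<and> (\<exists>u\<in>X. f u \<noteq> 0)" for f \<mu>
  have R_x: "(\<Sum>u\<in>X. f u * slack u x) + \<mu> * (1 - (\<Sum>t\<in>T. slack t x)) = 0" if "R f \<mu>" "x \<in> V" for f \<mu> x
  proof -
    have "lform ((\<Sum>u\<in>X. f u *\<^sub>R lift u) + \<mu> *\<^sub>R N) (lift x) = 0" using that by (simp add: R_def)
    then show ?thesis unfolding lform_add_left lform_sum_left lform_scale_left Nx[OF that(2)] lform_lift .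
  qed
  have R_N: "(\<Sum>u\<in>X. f u) = \<mu> * - lform N N" if "R f \<mu>" for f \<mu>
  proof -
    have "lform ((\<Sum>u\<in>X. f u *\<^sub>R lift u) + \<mu> *\<^sub>R N) N = 0" using that by (simp add: R_def)
    moreover have "(\<Sum>u\<in>X. f u * lform (lift u) N) = (\<Sum>u\<in>X. f u)"
      using Nx sT X by (intro sum.cong) (auto simp: lform_commute[of _ N])
    ultimately show ?thesis unfolding lform_add_left lform_sum_left lform_scale_left by simp
  qed
  have R_minus: "R (\<lambda>u. - f u) (- \<mu>)" if "R f \<mu>" for f \<mu>
  proof -
    have "(\<Sum>u\<in>X. - f u *\<^sub>R lift u) + - \<mu> *\<^sub>R N = - ((\<Sum>u\<in>X. f u *\<^sub>R lift u) + \<mu> *\<^sub>R N)"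
      by (simp add: sum_negf)
    also have "\<dots> = 0" using that by (simp only: R_def) simp
    finally show ?thesis using that by (simp only: R_def neg_equal_0_iff_equal simp_thms)
  qed
  have "\<exists>f \<mu>. R f \<mu>"
  proof -
    \<comment> \<open>\<open>n\<close> and the lifts of \<open>T \<union> X\<close> are \<open>d + 3\<close> vectors in \<open>U\<close>.\<close>
    have nl: "n \<notin> lift ` (T \<union> X)" using height_n by auto
    have TX: "card (T \<union> X) = card T + card X" using fin X(1) by (intro card_Un_disjoint) auto
    have "card (insert n (lift ` (T \<union> X))) = Suc (card T + card X)"
      using nl fin by (simp only: card_insert_disjoint finite_imageI finite_UnI card_lift TX not_False_eq_True)
    moreover have "insert n (lift ` (T \<union> X)) \<subseteq> U" using nU liftU T(1) X(1) by blast
    ultimately have "dependent (insert n (lift ` (T \<union> X)))"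
      using independent_card_le_dim[of "insert n (lift ` (T \<union> X))" U] dimU T(3) X(2) by fastforce
    then obtain g where g: "\<exists>v\<in>insert n (lift ` (T \<union> X)). g v \<noteq> 0"
      "(\<Sum>v\<in>insert n (lift ` (T \<union> X)). g v *\<^sub>R v) = 0"
      using fin by (subst (asm) real_vector.dependent_finite) auto
    have "(\<Sum>v\<in>lift ` (T \<union> X). g v *\<^sub>R v) = (\<Sum>v\<in>T \<union> X. g (lift v) *\<^sub>R lift v)"
      using sum.reindex[OF inj_on_subset[OF inj_lift subset_UNIV], of "\<lambda>v. g v *\<^sub>R v" "T \<union> X"] by simp
    also have "\<dots> = (\<Sum>v\<in>T. g (lift v) *\<^sub>R lift v) + (\<Sum>v\<in>X. g (lift v) *\<^sub>R lift v)"
      using fin X(1) by (intro sum.union_disjoint) auto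
    finally have e: "g n *\<^sub>R n + ((\<Sum>v\<in>T. g (lift v) *\<^sub>R lift v) + (\<Sum>v\<in>X. g (lift v) *\<^sub>R lift v)) = 0"
      using g(2) nl fin by simp
    have gt: "g (lift t) = - g n" if t: "t \<in> T" for t
    proof -
      have "t \<in> V" using t T by auto
      have "lform (\<Sum>v\<in>X. g (lift v) *\<^sub>R lift v) (lift t) = 0"
        unfolding lform_sum_left lform_lift using XT[OF _ t] by (intro sum.neutral) (simp add: slack_def)
      then have "lform (g n *\<^sub>R n + ((\<Sum>v\<in>T. g (lift v) *\<^sub>R lift v) + (\<Sum>v\<in>X. g (lift v) *\<^sub>R lift v))) (lift t)
        = g n + g (lift t)"
        using lform_sum_clique[OF fin(1) T(2) t, of "\<lambda>v. g (lift v)"] nx[OF \<open>t \<in> V\<close>]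
        by (simp only: lform_add_left lform_scale_left)
      then show ?thesis unfolding e by simp
    qed
    have "(\<Sum>v\<in>T. g (lift v) *\<^sub>R lift v) = (\<Sum>v\<in>T. - g n *\<^sub>R lift v)"
      using gt by (intro sum.cong) auto
    also have "\<dots> = - g n *\<^sub>R (\<Sum>v\<in>T. 1 *\<^sub>R lift v)" by (simp add: scaleR_sum_right)
    finally have rel: "(\<Sum>v\<in>X. g (lift v) *\<^sub>R lift v) + g n *\<^sub>R N = 0"
      using e by (simp add: N_def scaleR_diff_right algebra_simps)
    have "\<exists>u\<in>X. g (lift u) \<noteq> 0"
    proof (rule ccontr)
      assume "\<not> ?thesis"
      then have z: "\<And>u. u \<in> X \<Longrightarrow> g (lift u) = 0" by auto
      then have "g n *\<^sub>R N = 0" using rel by simp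
      moreover have "N \<noteq> 0" using NN_neg by auto
      ultimately have "g n = 0" by simp
      then show False using g(1) gt z by auto
    qed
    then show ?thesis using rel unfolding R_def by (intro exI[of _ "\<lambda>u. g (lift u)"] exI[of _ "g n"]) blast
  qed
  then obtain f \<mu> where R: "R f \<mu>" by blast
  have neg: "{u\<in>X. f u < 0} \<noteq> {}" if "R f \<mu>" for f \<mu>
  proof
    assume "{u\<in>X. f u < 0} = {}"
    then have nn: "\<forall>u\<in>X. 0 \<le> f u" by (auto simp: not_less)
    have "\<exists>u\<in>X. f u \<noteq> 0" using that unfolding R_def by (rule conjunct2)
    then obtain u where u: "u \<in> X" "f u \<noteq> 0" by blast
    have "(\<Sum>u\<in>X. f u) > 0" using u nn fin by (intro sum_pos2[of _ u]) (auto simp: less_le)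
    then have "\<mu> > 0" using R_N[OF that] NN_neg zero_less_mult_iff[of \<mu> "- lform N N"] by linarith
    moreover have uV: "u \<in> V" using u X by auto
    moreover have "0 \<le> (\<Sum>u'\<in>X. f u' * slack u' u)"
      using nn slack_ge_0 uV X by (intro sum_nonneg mult_nonneg_nonneg) auto
    ultimately show False using R_x[OF that uV] sT[OF u(1)] by simp
  qed
  have middle: "\<forall>x\<in>V. (\<Sum>t\<in>T. slack t x) < 1 \<longrightarrow> dist p x \<noteq> 1"
    if R: "R f \<mu>" and p: "p \<in> X" "f p < 0" and others: "\<And>u. u \<in> X - {p} \<Longrightarrow> 0 \<le> f u" for f \<mu> p
  proof -
    have split: "(\<Sum>u\<in>X. f u * h u) = f p * h p + (\<Sum>u\<in>X - {p}. f u * h u)" for h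
      using fin p by (simp add: sum.remove)
    have pV: "p \<in> V" using p X by auto
    have sl: "0 \<le> slack u x" if "u \<in> X" "x \<in> V" for u x using slack_ge_0 that X by auto
    have "\<mu> > 0"
    proof (rule ccontr)
      assume mu: "\<not> \<mu> > 0"
      have 1: "f p + (\<Sum>u\<in>X - {p}. f u) = \<mu> * - lform N N" using R_N[OF R] split[of "\<lambda>_. 1"] by simp
      have 2: "f p + (\<Sum>u\<in>X - {p}. f u * slack u p) + \<mu> = 0"
        using R_x[OF R pV] split[of "\<lambda>u. slack u p"] sT[OF p(1)] by (simp add: slack_def)
      have 3: "\<mu> * - lform N N \<le> 0" using mu NN_neg by (intro mult_nonpos_nonneg) linarith+
      have s1: "slack u p < 1" if "u \<in> X - {p}" for u using that by (auto simp: slack_def)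
      have "(\<Sum>u\<in>X - {p}. f u * (1 - slack u p)) \<le> 0"
        using 1 2 3 mu by (simp add: right_diff_distrib sum_subtractf)
      moreover have nn: "0 \<le> f u * (1 - slack u p)" if "u \<in> X - {p}" for u
        using others[OF that] s1[OF that] by simp
      ultimately have "(\<Sum>u\<in>X - {p}. f u * (1 - slack u p)) = 0"
        by (intro order.antisym sum_nonneg) auto
      then have "\<forall>u\<in>X - {p}. f u * (1 - slack u p) = 0"
        using sum_nonneg_eq_0_iff[of "X - {p}" "\<lambda>u. f u * (1 - slack u p)"] nn fin by blast
      then have "\<forall>u\<in>X - {p}. f u = 0" using s1 by fastforce
      then have "(\<Sum>u\<in>X - {p}. f u * slack u p) = 0" by simp
      then show False using 2 mu p by simp
    qed
    show ?thesis
    proof (intro ballI impI notI)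
      fix x assume x: "x \<in> V" "(\<Sum>t\<in>T. slack t x) < 1" "dist p x = 1"
      have "f p * slack p x + (\<Sum>u\<in>X - {p}. f u * slack u x) + \<mu> * (1 - (\<Sum>t\<in>T. slack t x)) = 0"
        using R_x[OF R x(1)] split[of "\<lambda>u. slack u x"] by simp
      moreover have "slack p x = 0" using x by (simp add: slack_def)
      moreover have "0 \<le> (\<Sum>u\<in>X - {p}. f u * slack u x)"
        using others sl x(1) by (intro sum_nonneg mult_nonneg_nonneg) auto
      moreover have "0 < \<mu> * (1 - (\<Sum>t\<in>T. slack t x))" using \<open>\<mu> > 0\<close> x(2) by simp
      ultimately show False by simp
    qed
  qed
  have single: "\<exists>p\<in>X. \<forall>x\<in>V. (\<Sum>t\<in>T. slack t x) < 1 \<longrightarrow> dist p x \<noteq> 1"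
    if R: "R f \<mu>" and c1: "card {u\<in>X. f u < 0} \<le> 1" for f \<mu>
  proof -
    have "finite {u\<in>X. f u < 0}" using fin by simp
    then have "card {u\<in>X. f u < 0} = 1" using c1 neg[OF R] card_gt_0_iff[of "{u\<in>X. f u < 0}"] by linarith
    then obtain p where p: "{u\<in>X. f u < 0} = {p}" by (rule card_1_singletonE)
    then have pX: "p \<in> X" "f p < 0" by blast+
    have "0 \<le> f u" if "u \<in> X - {p}" for u
    proof (rule ccontr)
      assume "\<not> 0 \<le> f u"
      then have "u \<in> {u\<in>X. f u < 0}" using that by simp
      then show False using p that by blast
    qed
    then show ?thesis using middle[OF R pX] pX by blast
  qed
  \<comment> \<open>Both signs occur among the three coefficients; up to negation, exactly one is negative.\<close>
  have "card {u\<in>X. f u < 0} + card {u\<in>X. - f u < 0} = card ({u\<in>X. f u < 0} \<union> {u\<in>X. - f u < 0})"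
    using fin by (intro card_Un_disjoint[symmetric]) auto
  also have "\<dots> \<le> 3" unfolding X(2)[symmetric] using fin by (intro card_mono) auto
  finally have "card {u\<in>X. f u < 0} \<le> 1 \<or> card {u\<in>X. - f u < 0} \<le> 1" by linarith
  then show ?thesis using single[OF R] single[OF R_minus[OF R]] by blast
qed

text \<open>
  Let \<open>p\<close> be the middle one of three vertices that extend \<open>T\<close>. A vertex \<open>x\<close> outside of \<open>T\<close> of another clique
  \<open>D\<close> through \<open>p\<close> has distance less than 1 from at least two vertices of \<open>T\<close>, by
  \<open>middle_extension\<close> and because slacks are less than 1. So \<open>D\<close> misses two vertices of \<open>T\<close>. It
  also misses another extending vertex \<open>u\<close>, which is not adjacent to \<open>p\<close>. Then \<open>D\<close> and \<open>insert u T\<close>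
  share at most \<open>d - 3\<close> vertices.
\<close>

lemma removable_vertex:
  assumes W: "W \<subseteq> V" and T: "Suc (card T) = d" "T \<noteq> {}"
    and three: "3 \<le> card {F \<in> unit_cliques d W. T \<subseteq> F}"
  shows "\<exists>p\<in>W. \<exists>F. {F \<in> unit_cliques d W. p \<in> F} \<subseteq> {F}"
proof -
  have finW: "finite W" using W finV by (rule finite_subset)
  define X0 where "X0 = {u \<in> W - T. insert u T \<in> unit_cliques d W}"
  have "{F \<in> unit_cliques d W. T \<subseteq> F} \<subseteq> (\<lambda>u. insert u T) ` X0"
  proof
    fix F assume F: "F \<in> {F \<in> unit_cliques d W. T \<subseteq> F}"
    then have "F \<in> unit_cliques (Suc (card T)) W" "T \<subseteq> F" using T by auto
    then obtain u where "u \<in> W - T" "F = insert u T" using finW by (rule_tac clique_eq_insert) auto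
    then show "F \<in> (\<lambda>u. insert u T) ` X0" using F by (auto simp: X0_def)
  qed
  moreover have "finite ((\<lambda>u. insert u T) ` X0)" using finW by (simp add: X0_def)
  ultimately have "3 \<le> card ((\<lambda>u. insert u T) ` X0)"
    using three card_mono order.trans by metis
  also have "\<dots> \<le> card X0" using finW by (intro card_image_le) (simp add: X0_def)
  finally obtain X where X: "X \<subseteq> X0" "card X = 3" by (rule obtain_subset_with_card_n)
  have ins: "insert u T \<subseteq> V" "unit_clique (insert u T)" "card (insert u T) = d" "u \<in> W - T" if "u \<in> X" for u
    using that X W by (auto simp: X0_def unit_cliques_def)
  have "X \<noteq> {}" using X(2) by auto
  then obtain u0 where u0: "u0 \<in> X" by blast
  have TV: "T \<subseteq> V" "unit_clique T" using ins[OF u0] unit_clique_subset[of "insert u0 T" T] by auto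
  have finT: "finite T" using TV(1) finV by (rule finite_subset)
  have XT: "dist u t = 1" if "u \<in> X" "t \<in> T" for u t
    using unit_cliqueD[OF ins(2)[OF that(1)], of u t] ins(4)[OF that(1)] that by auto
  have "X \<subseteq> V - T" using ins by auto
  from middle_extension[OF TV T this X(2) XT] obtain p
    where p: "p \<in> X" "\<And>x. x \<in> V \<Longrightarrow> (\<Sum>t\<in>T. slack t x) < 1 \<Longrightarrow> dist p x \<noteq> 1" by blast
  have "D = insert p T" if D: "D \<in> unit_cliques d W" "p \<in> D" for D
  proof (rule ccontr)
    assume ne: "D \<noteq> insert p T"
    have D': "D \<subseteq> V" "unit_clique D" "card D = d" using D W by (auto simp: unit_cliques_def)
    have "\<not> D \<subseteq> insert p T"
      using ne card_subset_eq[of "insert p T" D] finT D' ins(3)[OF p(1)] by auto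
    then obtain x where x: "x \<in> D" "x \<noteq> p" "x \<notin> T" by auto
    have ge1: "1 \<le> (\<Sum>t\<in>T. slack t x)"
      using p(2)[of x] unit_cliqueD[OF D'(2) D(2) x(1)] x D' by (auto simp: not_less[symmetric])
    have "slack t x = 0" if "t \<in> T" "t \<in> D" for t
    proof -
      have "t \<noteq> x" using that x by blast
      then show ?thesis using unit_cliqueD[OF D'(2) that(2) x(1)] by (simp add: slack_def)
    qed
    then have "(\<Sum>t\<in>T. slack t x) = (\<Sum>t\<in>T - D. slack t x)"
      using finT by (intro sum.mono_neutral_right) auto
    also have "\<dots> \<le> real (card (T - D)) * 1"
      using x by (intro sum_bounded_above) (simp add: slack_def)
    finally have le: "(\<Sum>t\<in>T. slack t x) \<le> card (T - D)" "(\<Sum>t\<in>T - D. slack t x) \<ge> 1"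
      using ge1 \<open>(\<Sum>t\<in>T. slack t x) = (\<Sum>t\<in>T - D. slack t x)\<close> by auto
    have "card (T - D) \<noteq> 1"
    proof
      assume "card (T - D) = 1"
      then obtain t where "T - D = {t}" by (rule card_1_singletonE)
      moreover from this have "t \<noteq> x" using x by blast
      ultimately show False using le(2) by (simp add: slack_def)
    qed
    then have c2: "2 \<le> card (T - D)" using le(1) ge1 by linarith
    have "\<not> X \<subseteq> {p}" using card_mono[of "{p}" X] X(2) by auto
    then obtain u where u: "u \<in> X" "u \<noteq> p" by blast
    have "dist p u \<noteq> 1"
    proof (rule p(2))
      show "u \<in> V" using ins(1)[OF u(1)] by auto
      have "(\<Sum>t\<in>T. slack t u) = 0"
        using XT[OF u(1)] by (intro sum.neutral) (simp add: slack_def dist_commute)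
      then show "(\<Sum>t\<in>T. slack t u) < 1" by simp
    qed
    then have "u \<notin> D" using unit_cliqueD[OF D'(2) D(2)] u by metis
    then have "D \<inter> insert u T = T \<inter> D" by auto
    then have "d \<le> card (T \<inter> D) + 2"
      using cliques_share[OF D' ins(1-3)[OF u(1)]] by simp
    moreover have "card T = card (T \<inter> D) + card (T - D)" using card_Int_Diff[OF finT] by simp
    ultimately show False using c2 T(1) by linarith
  qed
  then have "{F \<in> unit_cliques d W. p \<in> F} \<subseteq> {insert p T}" by blast
  moreover have "p \<in> W" using ins(4)[OF p(1)] by simp
  ultimately show ?thesis by blast
qed

end

section \<open>Counting cliques when every (d - 1)-set has at most two extensions\<close>

locale sparse_clique_family =
  fixes W :: "'a::metric_space set" and d :: nat
  assumes finW: "finite W" and d1: "1 \<le> d"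
    and share: "\<And>A B. A \<in> unit_cliques d W \<Longrightarrow> B \<in> unit_cliques d W \<Longrightarrow> d \<le> card (A \<inter> B) + 2"
    and sparse: "\<And>T. Suc (card T) = d \<Longrightarrow> card {F \<in> unit_cliques d W. T \<subseteq> F} \<le> 2"
begin

abbreviation \<F> :: "'a set set" where "\<F> \<equiv> unit_cliques d W"

lemma finF: "finite \<F>" by (rule finite_unit_cliques[OF finW])

lemma memberD: "F \<in> \<F> \<Longrightarrow> F \<subseteq> W" "F \<in> \<F> \<Longrightarrow> unit_clique F" "F \<in> \<F> \<Longrightarrow> card F = d" "F \<in> \<F> \<Longrightarrow> finite F"
  using finW finite_subset by (auto simp: unit_cliques_def)

lemma three_extensions:
  assumes T: "Suc (card T) = d" and F: "F1 \<in> \<F>" "F2 \<in> \<F>" "F3 \<in> \<F>" "T \<subseteq> F1" "T \<subseteq> F2" "T \<subseteq> F3"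
    and ne: "F1 \<noteq> F2" "F1 \<noteq> F3" "F2 \<noteq> F3"
  shows False
proof -
  have "card {F1, F2, F3} \<le> card {F \<in> \<F>. T \<subseteq> F}"
    using F finF by (intro card_mono) auto
  then show False using sparse[OF T] ne by simp
qed

text \<open>
  Fix a clique \<open>D\<close> that misses \<open>v\<close>, and let \<open>H\<close> be the set of neighbours of \<open>v\<close> in \<open>D\<close> outside of the core
  \<open>S\<close>. A clique \<open>F\<close> through \<open>v\<close> contains \<open>C = insert v S\<close>, and it meets \<open>D\<close> only in \<open>S \<union> H\<close>, so it
  contains at least \<open>k - 2\<close> elements of \<open>H\<close>, where \<open>k = d - card S\<close>. As subsets of \<open>C \<union> H\<close> are
  cliques themselves, sparsity leaves at most \<open>k\<close> choices for \<open>F\<close>. The three cases are \<open>card H \<le> k - 2\<close>,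
  where \<open>C \<union> H\<close> has at most two extensions; \<open>card H = k - 1\<close>, where \<open>C \<union> H\<close> is a clique and every other
  \<open>F\<close> is determined by the element of \<open>H\<close> that it omits; and \<open>card H = k\<close>, where \<open>F\<close> is \<open>C \<union> H\<close> without
  one element of \<open>H\<close>.
\<close>

lemma degree_le:
  assumes v: "v \<notin> \<Inter>\<F>"
  shows "card {F \<in> \<F>. v \<in> F} \<le> d - card (\<Inter>\<F>)"
proof (cases "{F \<in> \<F>. v \<in> F} = {}")
  case False
  define N where "N = {F \<in> \<F>. v \<in> F}"
  define S where "S = \<Inter>\<F>"
  define k where "k = d - card S"
  obtain F0 where F0: "F0 \<in> \<F>" "v \<in> F0" using False by blast
  obtain D where D: "D \<in> \<F>" "v \<notin> D" using v by blast
  define H where "H = {u \<in> D - S. dist u v = 1}"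
  define C where "C = insert v S"
  have SF: "S \<subseteq> F" if "F \<in> \<F>" for F using that by (auto simp: S_def)
  have finS: "finite S" using SF[OF D(1)] memberD(4)[OF D(1)] by (rule finite_subset)
  have vS: "v \<notin> S" using v by (simp add: S_def)
  have "S \<subset> F0" using SF[OF F0(1)] F0(2) vS by blast
  then have "card S < d" using psubset_card_mono[OF memberD(4)[OF F0(1)]] memberD(3)[OF F0(1)] by simp
  then have dk: "d = card S + k" "0 < k" by (auto simp: k_def)
  have finH: "finite H" using memberD(4)[OF D(1)] by (simp add: H_def)
  have HD: "H \<subseteq> D - S" by (auto simp: H_def)
  have cH: "card H \<le> k"
    using card_mono[OF _ HD] memberD(3,4)[OF D(1)] SF[OF D(1)] finS by (simp add: card_Diff_subset k_def)
  have cC: "card C = Suc (card S)" "finite C" using finS vS by (auto simp: C_def)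
  have CH: "C \<inter> H = {}" using HD D(2) by (auto simp: C_def)
  have CN: "C \<subseteq> F" if "F \<in> N" for F using that SF by (auto simp: N_def C_def)
  have NF: "N \<subseteq> \<F>" "finite N" using finF by (auto simp: N_def)
  have cCX: "card (C \<union> X) = Suc (card S) + card X" if "X \<subseteq> H" for X
    using card_Un_disjoint[of C X] cC CH that finite_subset[OF that finH] by auto
  have cliq: "unit_clique (C \<union> H)"
    unfolding unit_clique_def
  proof (intro ballI impI)
    fix x y assume xy: "x \<in> C \<union> H" "y \<in> C \<union> H" "x \<noteq> y"
    have "C \<subseteq> F0" using CN[of F0] F0 by (simp add: N_def)
    moreover have "S \<union> H \<subseteq> D" using HD SF[OF D(1)] by blast
    moreover have "dist u v = 1" "dist v u = 1" if "u \<in> H" for u using that by (auto simp: H_def dist_commute)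
    moreover have "x \<in> H \<or> x = v \<or> x \<in> S" "y \<in> H \<or> y = v \<or> y \<in> S" using xy by (auto simp: C_def)
    ultimately show "dist x y = 1"
      using unit_cliqueD[OF memberD(2)[OF F0(1)], of x y] unit_cliqueD[OF memberD(2)[OF D(1)], of x y] xy
      by (smt (verit, best) Un_iff subsetD)
  qed
  have CHW: "C \<union> H \<subseteq> W"
  proof -
    have "C \<subseteq> W" using CN[of F0] F0 memberD(1)[OF F0(1)] by (auto simp: N_def)
    moreover have "H \<subseteq> W" using HD memberD(1)[OF D(1)] by blast
    ultimately show ?thesis by blast
  qed
  have inF: "C \<union> X \<in> \<F>" if "X \<subseteq> H" "Suc (card X) = k" for X
    using that cCX[OF that(1)] dk CHW unit_clique_subset[OF cliq, of "C \<union> X"] by (auto simp: unit_cliques_def)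
  have meet: "k \<le> card (F \<inter> H) + 2" "Suc (card (F \<inter> H)) \<le> k" if F: "F \<in> N" for F
  proof -
    have FF: "F \<in> \<F>" using F NF by blast
    have "u \<in> S \<union> (F \<inter> H)" if u: "u \<in> F \<inter> D" for u
    proof -
      have "u \<noteq> v" using u D by blast
      moreover have "v \<in> F" using F by (simp add: N_def)
      ultimately have "dist u v = 1" using unit_cliqueD[OF memberD(2)[OF FF], of u v] u by blast
      then show ?thesis using u by (auto simp: H_def)
    qed
    then have "card (F \<inter> D) \<le> card (S \<union> (F \<inter> H))" using finS finH by (intro card_mono) auto
    also have "\<dots> \<le> card S + card (F \<inter> H)" by (rule card_Un_le)
    finally show "k \<le> card (F \<inter> H) + 2" using share[OF FF D(1)] dk by linarith
    have "card (C \<union> (F \<inter> H)) \<le> card F"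
      using CN[OF F] memberD(4)[OF FF] by (intro card_mono) auto
    then show "Suc (card (F \<inter> H)) \<le> k" using cCX[of "F \<inter> H"] memberD(3)[OF FF] dk by simp
  qed
  have eqF: "F = C \<union> (F \<inter> H)" if "F \<in> N" "Suc (card (F \<inter> H)) = k" for F
  proof (rule card_subset_eq[symmetric])
    have FF: "F \<in> \<F>" using that NF by blast
    show "finite F" by (rule memberD(4)[OF FF])
    show "C \<union> F \<inter> H \<subseteq> F" using CN[OF that(1)] by blast
    show "card (C \<union> F \<inter> H) = card F" using cCX[of "F \<inter> H"] that dk memberD(3)[OF FF] by simp
  qed
  have "card N \<le> k"
  proof -
    consider "card H + 2 \<le> k" | "Suc (card H) = k" | "card H = k" using cH by linarith
    then show ?thesis
    proof cases
      case 1
      have sub: "C \<union> H \<subseteq> F" if "F \<in> N" for F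
      proof -
        have "card H \<le> card (F \<inter> H)" using meet(1)[OF that] 1 by linarith
        then have "F \<inter> H = H" using finH by (intro card_seteq) auto
        then show ?thesis using CN[OF that] by blast
      qed
      have "F0 \<in> N" using F0 by (simp add: N_def)
      then have "card H + 2 = k" using meet(1)[of F0] 1 card_mono[OF finH, of "F0 \<inter> H"] by auto
      then have "card {F \<in> \<F>. C \<union> H \<subseteq> F} \<le> 2" using cCX[of H] dk by (intro sparse) simp
      moreover have "card N \<le> card {F \<in> \<F>. C \<union> H \<subseteq> F}"
        using sub NF finF by (intro card_mono) auto
      ultimately show ?thesis using 1 by linarith
    next
      case 2
      define G where "G = C \<union> H"
      have G: "G \<in> \<F>" using inF[of H] 2 by (simp add: G_def)
      have h: "\<exists>h\<in>H. F \<inter> H = H - {h}" if F: "F \<in> N - {G}" for F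
      proof -
        have "F \<inter> H \<noteq> H"
        proof
          assume "F \<inter> H = H"
          then have "F = G" using eqF[of F] F 2 by (simp add: G_def)
          then show False using F by blast
        qed
        then have "card (H - F) \<noteq> 0" using finH by auto
        moreover have "card H = card (F \<inter> H) + card (H - F)"
          using card_Int_Diff[OF finH, of F] by (simp add: Int_commute)
        ultimately have "card (H - F) = 1" using meet(1)[of F] F 2 by auto
        then obtain h where "H - F = {h}" by (rule card_1_singletonE)
        then show ?thesis by (intro bexI[of _ h]) auto
      qed
      have "inj_on (\<lambda>F. F \<inter> H) (N - {G})"
      proof (rule inj_onI, rule ccontr)
        fix F F' assume F: "F \<in> N - {G}" "F' \<in> N - {G}" "F \<inter> H = F' \<inter> H" and ne: "F \<noteq> F'"
        obtain h where hh: "h \<in> H" "F \<inter> H = H - {h}" using h[OF F(1)] by blast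
        show False
        proof (rule three_extensions[of "C \<union> (F \<inter> H)" G F F'])
          show "Suc (card (C \<union> F \<inter> H)) = d"
            using cCX[of "F \<inter> H"] hh(2) 2 dk card_Suc_Diff1[OF finH hh(1)] by simp
          show "G \<in> \<F>" "F \<in> \<F>" "F' \<in> \<F>" using G F(1,2) NF by blast+
          show "C \<union> F \<inter> H \<subseteq> G" by (auto simp: G_def)
          show "C \<union> F \<inter> H \<subseteq> F" using CN[of F] F(1) by blast
          show "C \<union> F \<inter> H \<subseteq> F'" using CN[of F'] F(2,3) by blast
          show "G \<noteq> F" "G \<noteq> F'" "F \<noteq> F'" using F(1,2) ne by blast+
        qed
      qed
      then have "card (N - {G}) = card ((\<lambda>F. F \<inter> H) ` (N - {G}))" by (simp add: card_image)
      also have "\<dots> \<le> card ((\<lambda>h. H - {h}) ` H)" using h finH by (intro card_mono) auto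
      also have "\<dots> \<le> card H" using finH by (rule card_image_le)
      finally show ?thesis using card_Diff1_le[of N G] card_Suc_Diff1[of N G] NF 2 by (cases "G \<in> N") auto
    next
      case 3
      have "\<exists>h\<in>H. F = C \<union> (H - {h})" if F: "F \<in> N" for F
      proof -
        have FF: "F \<in> \<F>" using F NF by blast
        have split: "card H = card (F \<inter> H) + card (H - F)"
          using card_Int_Diff[OF finH, of F] by (simp add: Int_commute)
        have "card (H - F) \<noteq> 2"
        proof
          assume c2: "card (H - F) = 2"
          then obtain h h' where hh: "H - F = {h, h'}" "h \<noteq> h'" by (auto simp: card_2_iff)
          define T where "T = C \<union> (F \<inter> H)"
          have HF: "F \<inter> H \<union> {h} = H - {h'}" "F \<inter> H \<union> {h'} = H - {h}" using hh by auto
          have hH: "h \<in> H" "h' \<in> H" "h \<notin> F" "h' \<notin> F" using hh by auto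
          have hC: "h \<notin> C" "h' \<notin> C" using hH CH by auto
          show False
          proof (rule three_extensions[of T F "C \<union> (H - {h'})" "C \<union> (H - {h})"])
            show "Suc (card T) = d" unfolding T_def using cCX[of "F \<inter> H"] split c2 3 dk by simp
            show "C \<union> (H - {h'}) \<in> \<F>" using hH finH 3 dk by (intro inF) auto
            show "C \<union> (H - {h}) \<in> \<F>" using hH finH 3 dk by (intro inF) auto
            show "T \<subseteq> F" using CN[OF F] by (auto simp: T_def)
            show "T \<subseteq> C \<union> (H - {h'})" "T \<subseteq> C \<union> (H - {h})" using hH by (auto simp: T_def)
            show "F \<noteq> C \<union> (H - {h'})" using hH hh(2) by blast
            show "F \<noteq> C \<union> (H - {h})" using hH hh(2) by blast
            show "C \<union> (H - {h'}) \<noteq> C \<union> (H - {h})" using hH hh(2) hC by blast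
          qed (rule FF)
        qed
        then have c1: "card (H - F) = 1" using split meet[OF F] 3 by linarith
        then obtain h where h: "H - F = {h}" by (rule card_1_singletonE)
        have "F = C \<union> (F \<inter> H)" using c1 split 3 by (intro eqF F) simp
        moreover have "F \<inter> H = H - {h}" using h by auto
        ultimately show ?thesis using h by (intro bexI[of _ h]) auto
      qed
      then have "N \<subseteq> (\<lambda>h. C \<union> (H - {h})) ` H" by blast
      then have "card N \<le> card H" using finH by (rule surj_card_le[rotated])
      then show ?thesis using 3 by simp
    qed
  qed
  then show ?thesis by (simp add: N_def k_def S_def)
qed (erule ssubst, simp)

text \<open>
  Each clique has \<open>d - card S\<close> vertices outside of the core \<open>S\<close>, and each vertex outside of the core lies in
  at most \<open>d - card S\<close> cliques.
\<close>

lemma card_le: "card \<F> \<le> card W"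
proof (cases "\<F> = {}")
  case False
  then obtain F0 where F0: "F0 \<in> \<F>" by blast
  define S where "S = \<Inter>\<F>"
  have SF: "S \<subseteq> F" if "F \<in> \<F>" for F using that by (auto simp: S_def)
  have finS: "finite S" using SF[OF F0] memberD(4)[OF F0] by (rule finite_subset)
  have cS: "card S \<le> d" using card_mono[OF memberD(4)[OF F0] SF[OF F0]] memberD(3)[OF F0] by simp
  show ?thesis
  proof (cases "card S = d")
    case True
    have "F = S" if "F \<in> \<F>" for F
      using card_subset_eq[OF memberD(4)[OF that] SF[OF that]] memberD(3)[OF that] True by simp
    then have "\<F> \<subseteq> {S}" by blast
    then have "card \<F> \<le> 1" using card_mono[of "{S}" \<F>] by simp
    also have "1 \<le> card F0" using memberD(3)[OF F0] d1 by simp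
    also have "card F0 \<le> card W" using memberD(1)[OF F0] finW by (intro card_mono)
    finally show ?thesis .
  next
    case False
    then have k: "0 < d - card S" using cS by simp
    have "(\<Sum>v\<in>W - S. card {F \<in> \<F>. v \<in> F}) = (d - card S) * card \<F>"
    proof (rule sum_multicount[OF _ finF])
      show "\<forall>F\<in>\<F>. card {v \<in> W - S. v \<in> F} = d - card S"
      proof
        fix F assume F: "F \<in> \<F>"
        have "{v \<in> W - S. v \<in> F} = F - S" using memberD(1)[OF F] by blast
        then show "card {v \<in> W - S. v \<in> F} = d - card S"
          using card_Diff_subset[OF finS SF[OF F]] memberD(3)[OF F] by simp
      qed
    qed (use finW in simp)
    moreover have "(\<Sum>v\<in>W - S. card {F \<in> \<F>. v \<in> F}) \<le> (\<Sum>v\<in>W - S. d - card S)"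
      using degree_le by (intro sum_mono) (auto simp: S_def)
    moreover have "(\<Sum>v\<in>W - S. d - card S) \<le> (d - card S) * card W"
      using finW card_mono[of W "W - S"] by (simp add: mult.commute)
    ultimately have "(d - card S) * card \<F> \<le> (d - card S) * card W" by linarith
    then show ?thesis using k by simp
  qed
qed simp

end

section \<open>The upper bound in a Lorentz model\<close>

context diameter_model begin

text \<open>
  Deleting a removable vertex decreases the number of cliques by at most 1. For \<open>d = 1\<close> the argument for
  removable vertices is not available, since \<open>T\<close> would be empty, but then cliques are just vertices.
\<close>

theorem card_unit_cliques_le:
  assumes d: "1 \<le> d"
  shows "W \<subseteq> V \<Longrightarrow> card (unit_cliques d W) \<le> card W"
proof (induction "card W" arbitrary: W rule: less_induct)
  case less
  have finW: "finite W" using less.prems finV by (rule finite_subset)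
  show ?case
  proof (cases "\<exists>T. Suc (card T) = d \<and> 3 \<le> card {F \<in> unit_cliques d W. T \<subseteq> F}")
    case False
    interpret sparse_clique_family W d
    proof
      show "d \<le> card (A \<inter> B) + 2" if "A \<in> unit_cliques d W" "B \<in> unit_cliques d W" for A B
        using that less.prems by (intro cliques_share) (auto simp: unit_cliques_def)
      show "card {F \<in> unit_cliques d W. T \<subseteq> F} \<le> 2" if "Suc (card T) = d" for T
        using False that by force
    qed (use finW d in auto)
    show ?thesis by (rule card_le)
  next
    case True
    then obtain T where T: "Suc (card T) = d" "3 \<le> card {F \<in> unit_cliques d W. T \<subseteq> F}" by blast
    show ?thesis
    proof (cases "d = 1")
      case True
      have "unit_cliques d W \<subseteq> (\<lambda>x. {x}) ` W"
        using True by (auto simp: unit_cliques_def card_1_singleton_iff)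
      then show ?thesis using finW by (rule surj_card_le[rotated])
    next
      case False
      then have "T \<noteq> {}" using T(1) by auto
      from removable_vertex[OF less.prems T(1) this T(2)] obtain p F
        where p: "p \<in> W" "{F \<in> unit_cliques d W. p \<in> F} \<subseteq> {F}" by blast
      have c: "card (W - {p}) < card W" using finW p(1) by (rule card_Diff1_less)
      have IH: "card (unit_cliques d (W - {p})) \<le> card (W - {p})"
        using less.prems by (intro less.hyps[OF c]) auto
      have "unit_cliques d W \<subseteq> insert F (unit_cliques d (W - {p}))"
        using p(2) by (auto simp: unit_cliques_def)
      then have "card (unit_cliques d W) \<le> card (insert F (unit_cliques d (W - {p})))"
        using finite_unit_cliques[of "W - {p}" d] finW by (intro card_mono) auto
      also have "\<dots> \<le> Suc (card (unit_cliques d (W - {p})))" by (rule card_insert_le_m1) simp_all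
      also have "\<dots> \<le> card W" using IH c by linarith
      finally show ?thesis .
    qed
  qed
qed

end

section \<open>Euclidean space and spheres as Lorentz models\<close>

lemma diameter_model_space:
  fixes V :: "'a::euclidean_space set"
  assumes "finite V" "\<And>x y. x \<in> V \<Longrightarrow> y \<in> V \<Longrightarrow> dist x y \<le> 1"
  shows "diameter_model V UNIV (0, -1, 0) (DIM('a))"
  by unfold_locales (use assms in \<open>auto simp: lform_def height_def\<close>)

text \<open>
  On the sphere, \<open>x \<bullet> x\<close> is an affine function of \<open>x\<close>, so the lifts lie in a hyperplane of the lifted
  space. The vector that represents the height on this hyperplane has the square \<open>\<tau> = 1 / (1 - 2 * r\<^sup>2)\<close>,
  which is negative for \<open>r > 1 / sqrt 2\<close>.
\<close>

lemma diameter_model_sphere: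
  fixes V :: "'b::euclidean_space set"
  assumes fin: "finite V" and dist: "\<And>x y. x \<in> V \<Longrightarrow> y \<in> V \<Longrightarrow> dist x y \<le> 1"
    and V: "V \<subseteq> sphere c r" and r: "1 / sqrt 2 < r" and dim: "DIM('b) = d + 1"
  defines "\<tau> \<equiv> 1 / (1 - 2 * r\<^sup>2)"
  shows "diameter_model V (range (\<lambda>(x, s). (x, 2 * (x \<bullet> c) + (r\<^sup>2 - c \<bullet> c) * s, s)))
    (\<tau> *\<^sub>R c, (r\<^sup>2 + c \<bullet> c) * \<tau>, \<tau>) d"
proof -
  define g where "g = (\<lambda>(x :: 'b, s :: real). (x, 2 * (x \<bullet> c) + (r\<^sup>2 - c \<bullet> c) * s, s))"
  have lin: "linear g"
    by (rule linearI) (auto simp: g_def inner_add_left algebra_simps)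
  have "(1 / sqrt 2)\<^sup>2 < r\<^sup>2" using r by (intro power_strict_mono) auto
  then have r2: "1 - 2 * r\<^sup>2 < 0" by (simp add: power_divide)
  have \<tau>: "\<tau> * (1 - 2 * r\<^sup>2) = 1" "\<tau> < 0" using r2 by (auto simp: \<tau>_def)
  have n: "(\<tau> *\<^sub>R c, (r\<^sup>2 + c \<bullet> c) * \<tau>, \<tau>) = g (\<tau> *\<^sub>R c, \<tau>)" by (simp add: g_def algebra_simps)
  have "diameter_model V (range g) (g (\<tau> *\<^sub>R c, \<tau>)) d"
  proof
    show "subspace (range g)" using lin by (simp add: linear_subspace_image)
    show "dim (range g) \<le> d + 2"
      using dim_image_le[OF lin, of UNIV] dim by simp
    show "lift x \<in> range g" if "x \<in> V" for x
    proof -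
      have "(norm (x - c))\<^sup>2 = r\<^sup>2" using that V by (auto simp: dist_norm norm_minus_commute)
      then have "x \<bullet> x = 2 * (x \<bullet> c) + (r\<^sup>2 - c \<bullet> c)"
        by (simp add: power2_norm_eq_inner inner_diff_left inner_diff_right inner_commute)
      then have "lift x = g (x, 1)" by (simp add: lift_def g_def)
      then show ?thesis by simp
    qed
    show "lform (g (\<tau> *\<^sub>R c, \<tau>)) u = height u" if "u \<in> range g" for u
    proof -
      obtain x s where u: "u = g (x, s)" using \<open>u \<in> range g\<close> by auto
      have "lform (g (\<tau> *\<^sub>R c, \<tau>)) u = (\<tau> * (1 - 2 * r\<^sup>2)) * s"
        by (simp add: u g_def lform_def height_def inner_commute algebra_simps)
      then show ?thesis by (simp add: \<tau> u g_def height_def)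
    qed
    show "height (g (\<tau> *\<^sub>R c, \<tau>)) \<le> 0" using \<tau> by (simp add: g_def height_def)
  qed (use fin dist in auto)
  then show ?thesis by (simp only: n g_def)
qed

lemma cliques_eq_unit_cliques:
  assumes "diameter_graph V E"
  shows "cliques k V E = unit_cliques k V"
proof -
  have E: "{x, y} \<in> E \<longleftrightarrow> dist x y = 1" if "x \<in> V" "y \<in> V" for x y
    using assms that by (auto simp: diameter_graph_def doubleton_eq_iff dist_commute)
  have "finite V" using assms by (simp add: diameter_graph_def)
  then have "finite K" if "K \<subseteq> V" for K using that finite_subset by blast
  then show ?thesis
    using E by (auto simp: cliques_def unit_cliques_def nsets_def clique_def unit_clique_def subset_iff)
qed

lemma diameter_graph_dist_le:
  assumes "diameter_graph V E" "x \<in> V" "y \<in> V"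
  shows "dist x y \<le> 1"
  using assms diameter_bounded_bound[of V x y] by (auto simp: diameter_graph_def finite_imp_bounded)

section \<open>Diameter graphs with many cliques\<close>

lemma diameter_eq_1:
  fixes V :: "'a::real_normed_vector set"
  assumes "\<And>x y. x \<in> V \<Longrightarrow> y \<in> V \<Longrightarrow> dist x y \<le> 1" "p \<in> V" "q \<in> V" "dist p q = 1" "finite V"
  shows "diameter V = 1"
proof (rule order.antisym)
  show "diameter V \<le> 1" using assms(1) by (intro diameter_le) (auto simp: dist_norm)
  show "1 \<le> diameter V"
    using diameter_bounded_bound[of V p q] assms by (simp add: finite_imp_bounded)
qed

text \<open>
  The points are obtained by rescaling \<open>P + s \<cdot> Q\<close>, \<open>s \<ge> 0\<close>, to the norm of \<open>P\<close>.
\<close>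

lemma infinite_arc:
  fixes P Q :: "'v::real_inner"
  assumes PQ: "norm P = norm Q" "P \<noteq> Q" "0 \<le> P \<bullet> Q"
  shows "infinite {x. norm x = norm P \<and> (\<exists>\<alpha>\<ge>0. \<exists>\<beta>\<ge>0. x = \<alpha> *\<^sub>R P + \<beta> *\<^sub>R Q)}" (is "infinite ?A")
proof -
  have nz: "P \<noteq> 0" "Q \<noteq> 0" using PQ by auto
  define k where "k s = norm P / norm (P + s *\<^sub>R Q)" for s
  have pos: "norm (P + s *\<^sub>R Q) > 0" if "0 \<le> s" for s
  proof -
    have "0 < P \<bullet> P" using nz by simp
    then have "P \<bullet> (P + s *\<^sub>R Q) > 0" using PQ(3) that by (simp add: inner_add_right add_pos_nonneg)
    then show ?thesis by auto
  qed
  have kpos: "0 < k s" if "0 \<le> s" for s using pos[OF that] nz by (simp add: k_def)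
  have inj: "inj_on (\<lambda>s. k s *\<^sub>R (P + s *\<^sub>R Q)) {0..}"
  proof (rule inj_onI)
    fix s s' :: real assume s: "s \<in> {0..}" "s' \<in> {0..}" "k s *\<^sub>R (P + s *\<^sub>R Q) = k s' *\<^sub>R (P + s' *\<^sub>R Q)"
    then have e: "(k s - k s') *\<^sub>R P = (k s' * s' - k s * s) *\<^sub>R Q"
      by (simp add: algebra_simps)
    have "k s = k s'"
    proof (rule ccontr)
      assume ne: "k s \<noteq> k s'"
      define \<mu> where "\<mu> = (k s' * s' - k s * s) / (k s - k s')"
      have "P = (1 / (k s - k s')) *\<^sub>R ((k s - k s') *\<^sub>R P)" using ne by simp
      also have "\<dots> = \<mu> *\<^sub>R Q" unfolding e by (simp add: \<mu>_def)
      finally have P: "P = \<mu> *\<^sub>R Q" .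
      then have "\<bar>\<mu>\<bar> = 1" using PQ(1) nz by simp
      moreover have "0 \<le> \<mu>"
      proof (rule ccontr)
        assume "\<not> 0 \<le> \<mu>"
        then have "\<mu> * (Q \<bullet> Q) < 0" using nz by (intro mult_neg_pos) auto
        then show False using PQ(3) unfolding P by simp
      qed
      ultimately show False using P PQ(2) by simp
    qed
    then have "(k s * (s' - s)) *\<^sub>R Q = 0" using e by (simp add: right_diff_distrib)
    moreover have "k s \<noteq> 0" using kpos[of s] s(1) by simp
    ultimately show "s = s'" using nz by simp
  qed
  have sub: "(\<lambda>s. k s *\<^sub>R (P + s *\<^sub>R Q)) ` {0..} \<subseteq> ?A"
  proof (intro image_subsetI CollectI conjI)
    fix s :: real assume s: "s \<in> {0..}"
    show "norm (k s *\<^sub>R (P + s *\<^sub>R Q)) = norm P" using pos[of s] s by (simp add: k_def)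
    show "\<exists>\<alpha>\<ge>0. \<exists>\<beta>\<ge>0. k s *\<^sub>R (P + s *\<^sub>R Q) = \<alpha> *\<^sub>R P + \<beta> *\<^sub>R Q"
      using kpos[of s] s by (intro exI[of _ "k s"] exI[of _ "k s * s"] conjI) (auto simp: scaleR_add_right)
  qed
  have "infinite {0 :: real..}" by (simp add: infinite_Ici)
  then have "infinite ((\<lambda>s. k s *\<^sub>R (P + s *\<^sub>R Q)) ` {0..})" by (simp add: finite_image_iff[OF inj])
  with sub show ?thesis by (rule infinite_super)
qed

text \<open>
  Two points of an arc of at most a quarter circle are no farther apart than its endpoints. A point of the
  arc is a combination of the endpoints with coefficients of sum at least 1, so its product with a
  vector \<open>z\<close> is at least the minimum of the products of the endpoints with \<open>z\<close>, if these are nonnegative.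
  This is applied twice.
\<close>

lemma arc_dist_le:
  fixes P Q :: "'v::real_inner"
  assumes PQ: "norm P = norm Q" "0 \<le> P \<bullet> Q"
    and x: "norm x = norm P" "x = \<alpha> *\<^sub>R P + \<beta> *\<^sub>R Q" "0 \<le> \<alpha>" "0 \<le> \<beta>"
    and y: "norm y = norm P" "y = \<gamma> *\<^sub>R P + \<delta> *\<^sub>R Q" "0 \<le> \<gamma>" "0 \<le> \<delta>"
  shows "dist x y \<le> dist P Q"
proof (cases "P = 0")
  case True
  then show ?thesis using assms by auto
next
  case False
  have R: "Q \<bullet> Q = P \<bullet> P" "x \<bullet> x = P \<bullet> P" "y \<bullet> y = P \<bullet> P" using PQ x y by (simp_all add: norm_eq)
  have ge1: "1 \<le> a + b" if "norm P = norm (a *\<^sub>R P + b *\<^sub>R Q)" "0 \<le> a" "0 \<le> b" for a b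
  proof -
    have "norm P * 1 \<le> norm P * (a + b)"
      using that norm_triangle_ineq[of "a *\<^sub>R P" "b *\<^sub>R Q"] PQ(1) by (simp add: algebra_simps)
    then show ?thesis using False mult_le_cancel_left_pos[of "norm P" 1 "a + b"] by simp
  qed
  have PQle: "P \<bullet> Q \<le> P \<bullet> P"
    using norm_cauchy_schwarz[of P Q] PQ(1) by (simp add: norm_eq_sqrt_inner)
  have lower: "z \<le> a * s + b * t" if "1 \<le> a + b" "0 \<le> a" "0 \<le> b" "z \<le> s" "z \<le> t" "0 \<le> z" for a b s t z :: real
  proof -
    have "z \<le> (a + b) * z" using that mult_right_mono[of 1 "a + b" z] by simp
    also have "\<dots> \<le> a * s + b * t" unfolding distrib_right using that by (intro add_mono mult_left_mono) auto
    finally show ?thesis .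
  qed
  have ab: "1 \<le> \<alpha> + \<beta>" and cd: "1 \<le> \<gamma> + \<delta>" using ge1 x y by auto
  have xP: "P \<bullet> Q \<le> P \<bullet> x" "P \<bullet> Q \<le> Q \<bullet> x"
    unfolding x(2) inner_add_right inner_scaleR_right
    using PQ(2) PQle R x ab by (auto intro!: lower simp: inner_commute)
  have "P \<bullet> Q \<le> y \<bullet> x"
    unfolding y(2) inner_add_left inner_scaleR_left using PQ(2) xP y cd by (intro lower) auto
  then have "(dist x y)\<^sup>2 \<le> (dist P Q)\<^sup>2"
    using R by (simp add: dist_norm power2_norm_eq_inner inner_diff_left inner_diff_right inner_commute)
  then show ?thesis by (rule power2_le_imp_le) simp
qed

text \<open>
  On the line the cliques of size 1 are the vertices, and \<open>n\<close> equally spaced points will do.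
\<close>

lemma ex_many_cliques_line:
  assumes dim: "DIM('a::euclidean_space) = 1" and n: "2 \<le> n"
  shows "\<exists>V :: 'a set. finite V \<and> card V = n \<and> diameter V = 1 \<and> n \<le> card (unit_cliques (DIM('a)) V)"
proof -
  obtain b :: 'a where b: "b \<in> Basis" using nonempty_Basis by blast
  define f where "f i = (real i / real (n - 1)) *\<^sub>R b" for i :: nat
  define V where "V = f ` {..<n}"
  have fdist: "dist (f i) (f j) = \<bar>real i - real j\<bar> / real (n - 1)" for i j
  proof -
    have "f i - f j = ((real i - real j) / real (n - 1)) *\<^sub>R b"
      by (simp add: f_def scaleR_diff_left[symmetric] diff_divide_distrib)
    then show ?thesis using b by (simp add: dist_norm)
  qed
  have inj: "inj_on f {..<n}"
  proof (rule inj_onI)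
    fix i j assume "f i = f j"
    then have "dist (f i) (f j) = 0" by simp
    then show "i = j" using n unfolding fdist by simp
  qed
  have card: "card V = n" "finite V" using inj by (auto simp: V_def card_image)
  have "diameter V = 1"
  proof (rule diameter_eq_1)
    show "f 0 \<in> V" "f (n - 1) \<in> V" using n by (auto simp: V_def)
    show "dist (f 0) (f (n - 1)) = 1" using n by (simp add: fdist)
    fix x y assume "x \<in> V" "y \<in> V"
    then obtain i j where ij: "i < n" "j < n" "x = f i" "y = f j" by (auto simp: V_def)
    then have "\<bar>real i - real j\<bar> \<le> real (n - 1)" by linarith
    then show "dist x y \<le> 1" using n by (simp add: ij fdist divide_le_eq_1)
  qed (rule card(2))
  moreover have "(\<lambda>x. {x}) ` V \<subseteq> unit_cliques (DIM('a)) V"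
    using dim by (auto simp: unit_cliques_def unit_clique_def)
  then have "card ((\<lambda>x. {x}) ` V) \<le> card (unit_cliques (DIM('a)) V)"
    using card by (intro card_mono finite_unit_cliques)
  then have "n \<le> card (unit_cliques (DIM('a)) V)" using card by (simp add: card_image)
  ultimately show ?thesis using card by blast
qed

text \<open>
  The cliques counted are \<open>insert y T\<close> for \<open>y \<in> Y\<close>, and \<open>T \<union> {p, q}\<close> without one element of \<open>T\<close>.
\<close>

lemma card_cliques_ge:
  fixes T :: "'a::metric_space set"
  assumes fin: "finite T" "finite Y" and pq: "p \<in> Y" "q \<in> Y" "dist p q = 1" and T: "unit_clique T" "T \<noteq> {}"
    and TY: "\<And>t y. t \<in> T \<Longrightarrow> y \<in> Y \<Longrightarrow> dist t y = 1"
  shows "card Y + card T \<le> card (unit_cliques (Suc (card T)) (T \<union> Y))"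
proof -
  have disj: "t \<notin> Y" if "t \<in> T" for t using TY[OF that, of t] by auto
  have pq': "p \<noteq> q" "p \<notin> T" "q \<notin> T" using pq disj by auto
  have cl: "unit_clique (insert p (insert q T))"
    using T(1) TY pq by (auto simp: unit_clique_def dist_commute)
  define f where "f y = insert y T" for y
  define g where "g t = insert p (insert q (T - {t}))" for t
  have fsub: "f ` Y \<subseteq> unit_cliques (Suc (card T)) (T \<union> Y)"
  proof (rule image_subsetI)
    fix y assume y: "y \<in> Y"
    have "unit_clique (f y)" using T(1) TY[OF _ y] by (auto simp: f_def unit_clique_def dist_commute)
    moreover have "card (f y) = Suc (card T)" using y disj fin by (auto simp: f_def card_insert_if)
    ultimately show "f y \<in> unit_cliques (Suc (card T)) (T \<union> Y)" using y by (auto simp: unit_cliques_def f_def)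
  qed
  have gsub: "g ` T \<subseteq> unit_cliques (Suc (card T)) (T \<union> Y)"
  proof (rule image_subsetI)
    fix t assume t: "t \<in> T"
    have "unit_clique (g t)" by (rule unit_clique_subset[OF cl]) (auto simp: g_def)
    moreover have "card (g t) = Suc (Suc (card (T - {t})))" using pq' fin by (simp add: g_def)
    then have "card (g t) = Suc (card T)" using card_Suc_Diff1[OF fin(1) t] by simp
    moreover have "g t \<subseteq> T \<union> Y" using pq by (auto simp: g_def)
    ultimately show "g t \<in> unit_cliques (Suc (card T)) (T \<union> Y)" by (simp add: unit_cliques_def)
  qed
  have injf: "inj_on f Y"
  proof (rule inj_onI)
    fix x y assume "x \<in> Y" "y \<in> Y" "f x = f y"
    then show "x = y" using disj unfolding f_def by blast
  qed
  have injg: "inj_on g T"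
  proof (rule inj_onI)
    fix s t assume st: "s \<in> T" "t \<in> T" "g s = g t"
    have "s \<notin> g s" using st(1) pq' by (auto simp: g_def)
    then have "s \<notin> g t" using st(3) by simp
    then show "s = t" using st(1) by (simp add: g_def)
  qed
  have "f ` Y \<inter> g ` T = {}" using pq' by (auto simp: f_def g_def)
  then have "card (f ` Y \<union> g ` T) = card Y + card T"
    using fin injf injg by (simp add: card_Un_disjoint card_image)
  then show ?thesis
    using card_mono[OF _ Un_least[OF fsub gsub]] finite_unit_cliques[of "T \<union> Y"] fin by simp
qed

text \<open>
  The simplex consists of the basis vectors divided by \<open>sqrt 2\<close> and of a point \<open>p\<close> on the diagonal. Its
  vertices other than \<open>p\<close> and \<open>q\<close> form \<open>T\<close>, with centroid \<open>c\<close>; all points of the arc from \<open>p\<close> to \<open>q\<close>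
  about \<open>c\<close> have distance 1 from \<open>T\<close>, because \<open>p - c\<close> and \<open>q - c\<close> are orthogonal to \<open>t - c\<close> for \<open>t \<in> T\<close>.
\<close>

lemma ex_many_cliques:
  assumes dim: "2 \<le> DIM('a::euclidean_space)" and n: "DIM('a) + 1 \<le> n"
  shows "\<exists>V :: 'a set. finite V \<and> card V = n \<and> diameter V = 1 \<and> n \<le> card (unit_cliques (DIM('a)) V)"
proof -
  define d where "d = real (DIM('a))"
  obtain b0 :: 'a where b0: "b0 \<in> Basis" using nonempty_Basis by blast
  define B where "B = (Basis :: 'a set) - {b0}"
  define m where "m = card B"
  have m: "DIM('a) = Suc m" using b0 by (simp add: m_def B_def)
  have finB: "finite B" by (simp add: B_def)
  define \<sigma> where "\<sigma> = 1 / sqrt 2"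
  have \<sigma>: "\<sigma> * \<sigma> = 1 / 2" "\<sigma> > 0" by (simp_all add: \<sigma>_def)
  define t where "t = (sqrt 2 + sqrt (2 + 2 * d)) / (2 * d)"
  have d0: "d > 0" "d = real m + 1" using dim m by (simp_all add: d_def)
  \<comment> \<open>\<open>t\<close> solves the quadratic equation that puts \<open>p\<close> at distance 1 from the scaled basis vectors.\<close>
  have "(2 * d * t - sqrt 2)\<^sup>2 = 2 + 2 * d" using d0 by (simp add: t_def)
  then have "4 * d * (d * t\<^sup>2 - sqrt 2 * t - 1/2) = 0"
    by (simp add: power2_eq_square algebra_simps)
  then have t: "d * t\<^sup>2 - sqrt 2 * t = 1/2" using d0 by simp
  define p where "p = t *\<^sub>R (\<Sum>b\<in>Basis. b :: 'a)"
  define q where "q = \<sigma> *\<^sub>R b0"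
  define c where "c = (\<sigma> / m) *\<^sub>R (\<Sum>b\<in>B. b)"
  define T where "T = (\<lambda>b. \<sigma> *\<^sub>R b) ` B"
  have m0: "m > 0" using dim m by simp
  have bb: "b \<bullet> b' = (if b = b' then 1 else 0)" if "b \<in> Basis" "b' \<in> Basis" for b b' :: 'a
    using that by (rule inner_Basis)
  have sumB: "(\<Sum>b\<in>B. b) \<bullet> b = (if b \<in> B then 1 else 0)" if "b \<in> Basis" for b :: 'a
  proof -
    have "(\<Sum>b'\<in>B. b' \<bullet> b) = (\<Sum>b'\<in>B. if b' = b then 1 else 0)"
      using that by (intro sum.cong) (auto simp: B_def bb)
    then show ?thesis using finB by (simp add: inner_sum_left)
  qed
  have sumBasis: "(\<Sum>b\<in>Basis. b) \<bullet> b = 1" if "b \<in> Basis" for b :: 'a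
  proof -
    have "(\<Sum>b'\<in>Basis. b' \<bullet> b) = (\<Sum>b'\<in>Basis. if b' = b then 1 else 0)"
      using that by (intro sum.cong) (auto simp: bb)
    then show ?thesis using that by (simp add: inner_sum_left)
  qed
  have BB: "b \<in> Basis" "b \<noteq> b0" if "b \<in> B" for b using that by (auto simp: B_def)
  have pb: "p \<bullet> b = t" if "b \<in> Basis" for b using sumBasis[OF that] by (simp add: p_def)
  have pp: "p \<bullet> p = d * t\<^sup>2"
  proof -
    have "p \<bullet> p = t * (\<Sum>b\<in>Basis. p \<bullet> b)" by (simp add: p_def inner_sum_right)
    also have "(\<Sum>b\<in>Basis. p \<bullet> b) = (\<Sum>b\<in>(Basis :: 'a set). t)" using pb by (intro sum.cong) auto
    finally show ?thesis by (simp add: d_def power2_eq_square)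
  qed
  have dist_p: "dist p (\<sigma> *\<^sub>R b) = 1" if "b \<in> Basis" for b
  proof -
    have "(dist p (\<sigma> *\<^sub>R b))\<^sup>2 = d * t\<^sup>2 - 2 * \<sigma> * t + \<sigma> * \<sigma>"
      using pb[OF that] that
      by (simp add: dist_norm power2_norm_eq_inner inner_diff_left inner_diff_right pp inner_commute algebra_simps)
    also have "2 * \<sigma> = sqrt 2" by (simp add: \<sigma>_def real_div_sqrt)
    finally have "(dist p (\<sigma> *\<^sub>R b))\<^sup>2 = 1\<^sup>2" using t \<sigma> by simp
    then show ?thesis by (rule power2_eq_imp_eq) simp_all
  qed
  have dist_bb: "dist (\<sigma> *\<^sub>R b) (\<sigma> *\<^sub>R b') = 1" if "b \<in> Basis" "b' \<in> Basis" "b \<noteq> b'" for b b' :: 'a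
  proof -
    have "(dist (\<sigma> *\<^sub>R b) (\<sigma> *\<^sub>R b'))\<^sup>2 = 1\<^sup>2"
      using that by (simp add: dist_norm power2_norm_eq_inner inner_diff_left inner_diff_right bb \<sigma>)
    then show ?thesis by (rule power2_eq_imp_eq) simp_all
  qed
  have cb: "c \<bullet> b = \<sigma> / m" if "b \<in> B" for b using sumB[of b] BB[OF that] that by (simp add: c_def)
  have orth: "z \<bullet> (\<sigma> *\<^sub>R b - c) = 0" if "b \<in> B" "\<And>b'. b' \<in> B \<Longrightarrow> z \<bullet> b' = s" for z s b
  proof -
    have "z \<bullet> c = \<sigma> / m * (\<Sum>b\<in>B. z \<bullet> b)" by (simp add: c_def inner_sum_right)
    also have "(\<Sum>b\<in>B. z \<bullet> b) = (\<Sum>b\<in>B. s)" using that by (intro sum.cong) auto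
    finally have "z \<bullet> c = \<sigma> * s" using m0 by (simp add: m_def)
    then show ?thesis using that by (simp add: inner_diff_right)
  qed
  define P where "P = p - c"
  define Q where "Q = q - c"
  have c_orth: "c \<bullet> (\<sigma> *\<^sub>R b - c) = 0" if "b \<in> B" for b by (rule orth[OF that cb])
  have p_orth: "p \<bullet> (\<sigma> *\<^sub>R b - c) = 0" if "b \<in> B" for b by (rule orth[OF that pb[OF BB(1)]])
  have qb: "q \<bullet> b = 0" if "b \<in> B" for b using bb[OF b0 BB(1)[OF that]] BB(2)[OF that] by (simp add: q_def)
  have q_orth: "q \<bullet> (\<sigma> *\<^sub>R b - c) = 0" if "b \<in> B" for b by (rule orth[OF that qb])
  have P_orth: "P \<bullet> (\<sigma> *\<^sub>R b - c) = 0" if "b \<in> B" for b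
    unfolding P_def inner_diff_left[of p] p_orth[OF that] c_orth[OF that] by simp
  have Q_orth: "Q \<bullet> (\<sigma> *\<^sub>R b - c) = 0" if "b \<in> B" for b
    unfolding Q_def inner_diff_left[of q] q_orth[OF that] c_orth[OF that] by simp
  have pyth: "(dist (c + x) (\<sigma> *\<^sub>R b))\<^sup>2 = (norm x)\<^sup>2 + (norm (\<sigma> *\<^sub>R b - c))\<^sup>2"
    if "x \<bullet> (\<sigma> *\<^sub>R b - c) = 0" for x b
  proof -
    have "c + x - \<sigma> *\<^sub>R b = x - (\<sigma> *\<^sub>R b - c)" by simp
    then show ?thesis unfolding dist_norm using that
      by (simp only: power2_norm_eq_inner inner_diff_left[of x] inner_diff_right[of _ x])
        (simp add: inner_commute)
  qed
  have cP: "c + P = p" "c + Q = q" by (simp_all add: P_def Q_def)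
  obtain b1 where b1: "b1 \<in> B" using m0 by (auto simp: m_def card_gt_0_iff)
  have dq: "dist q (\<sigma> *\<^sub>R b) = 1" if "b \<in> B" for b
    using dist_bb[OF b0 BB(1)[OF that]] BB(2)[OF that] by (auto simp: q_def)
  have normPQ: "norm P = norm Q"
  proof -
    have "(norm P)\<^sup>2 + (norm (\<sigma> *\<^sub>R b1 - c))\<^sup>2 = (norm Q)\<^sup>2 + (norm (\<sigma> *\<^sub>R b1 - c))\<^sup>2"
      using pyth[OF P_orth[OF b1]] pyth[OF Q_orth[OF b1]] dist_p[OF BB(1)[OF b1]] dq[OF b1] cP by simp
    then have "(norm P)\<^sup>2 = (norm Q)\<^sup>2" by simp
    then show ?thesis by (rule power2_eq_imp_eq) simp_all
  qed
  have "dist p q = 1" unfolding q_def by (rule dist_p[OF b0])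
  moreover have "dist P Q = dist p q" by (simp add: P_def Q_def dist_norm)
  ultimately have dPQ: "dist P Q = 1" by simp
  have ipPQ: "0 \<le> P \<bullet> Q"
  proof -
    have "c \<bullet> b0 = 0" using sumB[OF b0] by (simp add: c_def B_def)
    moreover have "p \<bullet> c = \<sigma> * t"
    proof -
      have "p \<bullet> c = \<sigma> / m * (\<Sum>b\<in>B. p \<bullet> b)" by (simp add: c_def inner_sum_right)
      also have "(\<Sum>b\<in>B. p \<bullet> b) = (\<Sum>b\<in>B. t)" using pb BB by (intro sum.cong) auto
      finally show ?thesis using m0 by (simp add: m_def)
    qed
    ultimately have "P \<bullet> Q = c \<bullet> c"
      using pb[OF b0] by (simp add: P_def Q_def q_def inner_diff_left inner_diff_right inner_commute)
    then show ?thesis by simp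
  qed
  define A where "A = {x. norm x = norm P \<and> (\<exists>\<alpha>\<ge>0. \<exists>\<beta>\<ge>0. x = \<alpha> *\<^sub>R P + \<beta> *\<^sub>R Q)}"
  have "P \<noteq> Q" using dPQ by auto
  have infA: "infinite A" unfolding A_def by (rule infinite_arc[OF normPQ \<open>P \<noteq> Q\<close> ipPQ])
  have PA: "P \<in> A" unfolding A_def
    by (intro CollectI conjI exI[of _ "1::real"] exI[of _ "0::real"]) auto
  have QA: "Q \<in> A" unfolding A_def
    by (intro CollectI conjI exI[of _ "0::real"] exI[of _ "1::real"]) (auto simp: normPQ)
  have "infinite (A - {P, Q})" using infA by simp
  then obtain X0 where X0: "finite X0" "card X0 = n - m - 2" "X0 \<subseteq> A - {P, Q}"
    using infinite_arbitrarily_large by metis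
  define X where "X = insert P (insert Q X0)"
  have XA: "X \<subseteq> A" and finX: "finite X" using X0 PA QA by (auto simp: X_def)
  have "P \<notin> insert Q X0" "Q \<notin> X0" using X0(3) \<open>P \<noteq> Q\<close> by auto
  then have cardX: "card X = n - m" using X0(1,2) n m by (simp add: X_def)
  define Y where "Y = (\<lambda>x. c + x) ` X"
  have cardY: "card Y = n - m" "finite Y" using cardX finX by (auto simp: Y_def card_image)
  have cardT: "card T = m" "finite T" using finB \<sigma>(2) by (auto simp: T_def m_def card_image inj_on_def)
  have TY: "dist t y = 1" if ty: "t \<in> T" "y \<in> Y" for t y
  proof -
    obtain b where b: "b \<in> B" "t = \<sigma> *\<^sub>R b" using ty by (auto simp: T_def)
    obtain x where x: "x \<in> A" "y = c + x" using ty XA by (auto simp: Y_def)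
    obtain \<alpha> \<beta> where x': "norm x = norm P" "x = \<alpha> *\<^sub>R P + \<beta> *\<^sub>R Q" using x by (auto simp: A_def)
    have "x \<bullet> (\<sigma> *\<^sub>R b - c) = 0"
      unfolding x'(2) inner_add_left inner_scaleR_left P_orth[OF b(1)] Q_orth[OF b(1)] by simp
    then have "(dist y t)\<^sup>2 = (dist p t)\<^sup>2"
      using pyth[of x b] pyth[OF P_orth[OF b(1)]] x'(1) cP by (simp add: b x)
    then have "(dist y t)\<^sup>2 = 1\<^sup>2" using dist_p[OF BB(1)[OF b(1)]] by (simp add: b)
    then show ?thesis using power2_eq_imp_eq[of "dist y t" 1] by (simp add: dist_commute)
  qed
  have YY: "dist x y \<le> 1" if xy: "x \<in> Y" "y \<in> Y" for x y
  proof -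
    obtain x' where x': "x' \<in> A" "x = c + x'" using xy XA by (auto simp: Y_def)
    obtain y' where y': "y' \<in> A" "y = c + y'" using xy XA by (auto simp: Y_def)
    obtain \<alpha> \<beta> where a: "norm x' = norm P" "x' = \<alpha> *\<^sub>R P + \<beta> *\<^sub>R Q" "0 \<le> \<alpha>" "0 \<le> \<beta>"
      using x'(1) by (auto simp: A_def)
    obtain \<gamma> \<delta> where b: "norm y' = norm P" "y' = \<gamma> *\<^sub>R P + \<delta> *\<^sub>R Q" "0 \<le> \<gamma>" "0 \<le> \<delta>"
      using y'(1) by (auto simp: A_def)
    have "dist x' y' \<le> 1" using arc_dist_le[OF normPQ ipPQ a b] dPQ by simp
    then show ?thesis by (simp add: x' y')
  qed
  have clT: "unit_clique T" unfolding unit_clique_def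
  proof (intro ballI impI)
    fix x y assume "x \<in> T" "y \<in> T" "x \<noteq> y"
    then show "dist x y = 1" using dist_bb BB(1) by (auto simp: T_def)
  qed
  have pY: "p \<in> Y" "q \<in> Y" unfolding Y_def cP[symmetric] by (simp_all add: X_def)
  have "T \<inter> Y = {}" using TY by force
  then have cardV: "card (T \<union> Y) = n" using cardT cardY n m by (simp add: card_Un_disjoint)
  have "diameter (T \<union> Y) = 1"
  proof (rule diameter_eq_1[of _ p q])
    show "dist x y \<le> 1" if xy: "x \<in> T \<union> Y" "y \<in> T \<union> Y" for x y
    proof -
      consider "x \<in> T" "y \<in> T" | "x \<in> T" "y \<in> Y" | "x \<in> Y" "y \<in> T" | "x \<in> Y" "y \<in> Y"
        using xy by blast
      then show ?thesis
      proof cases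
        case 1 then show ?thesis using unit_cliqueD[OF clT 1] by (cases "x = y") auto
      next
        case 2 then show ?thesis using TY by simp
      next
        case 3 then show ?thesis using TY[of y x] by (simp add: dist_commute)
      next
        case 4 then show ?thesis by (rule YY)
      qed
    qed
  qed (use pY \<open>dist p q = 1\<close> cardT cardY in auto)
  moreover have "card Y + card T \<le> card (unit_cliques (Suc (card T)) (T \<union> Y))"
    using b1 by (intro card_cliques_ge[OF cardT(2) cardY(2) pY \<open>dist p q = 1\<close> clT _ TY]) (auto simp: T_def)
  then have "n \<le> card (unit_cliques (DIM('a)) (T \<union> Y))" using cardT cardY n m by simp
  ultimately show ?thesis using cardV cardT cardY by (intro exI[of _ "T \<union> Y"]) auto
qed

section \<open>The number of d-cliques\<close>

theorem theorem5:
  fixes d :: nat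
  assumes "d \<ge> 1"
    and "DIM('a::euclidean_space) = d"
    and "DIM('b::euclidean_space) = d + 1"
  shows "(\<forall>n \<ge> d + 1. max_cliques TYPE('a) d n = n) \<and>
    (\<forall>r > 1 / sqrt 2. \<forall>n (c :: 'b) V E.
       diameter_graph V E \<and> V \<subseteq> sphere c r \<and> card V = n \<longrightarrow> card (cliques d V E) \<le> n)"
proof (intro conjI allI impI)
  fix n assume n: "d + 1 \<le> n"
  let ?counts = "{card (cliques d V E) | (V :: 'a set) E. diameter_graph V E \<and> card V = n}"
  have upper: "card (cliques d V E) \<le> n" if G: "diameter_graph V E" "card V = n" for V :: "'a set" and E
  proof -
    interpret diameter_model V UNIV "(0, -1, 0)" d
      using diameter_model_space[of V] G diameter_graph_dist_le[OF G(1)] assms(2)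
      by (auto simp: diameter_graph_def)
    show ?thesis using card_unit_cliques_le[OF assms(1) order_refl] G by (simp add: cliques_eq_unit_cliques)
  qed
  \<comment> \<open>The circle construction requires a nonempty \<open>T\<close>, so the line is treated separately.\<close>
  obtain V :: "'a set" where V: "finite V" "card V = n" "diameter V = 1" "n \<le> card (unit_cliques d V)"
  proof (cases "d = 1")
    case True
    then show ?thesis using ex_many_cliques_line[where 'a = 'a, of n] assms n that by auto
  next
    case False
    then show ?thesis using ex_many_cliques[where 'a = 'a, of n] assms n that by auto
  qed
  define E where "E = {{x, y} | x y. x \<in> V \<and> y \<in> V \<and> dist x y = 1}"
  have G: "diameter_graph V E" using V by (simp add: diameter_graph_def E_def)
  have "card (cliques d V E) = n"
    using upper[OF G V(2)] V(4) by (simp add: cliques_eq_unit_cliques[OF G])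
  then have "n \<in> ?counts" using G V(2) by (intro CollectI exI[of _ V] exI[of _ E]) simp
  moreover have "k \<le> n" if "k \<in> ?counts" for k using that upper by blast
  ultimately show "max_cliques TYPE('a) d n = n"
    unfolding max_cliques_def by (intro Max_eqI finite_clique_counts)
next
  fix r :: real and n and c :: 'b and V E
  assume r: "1 / sqrt 2 < r" and G: "diameter_graph V E \<and> V \<subseteq> sphere c r \<and> card V = n"
  have "diameter_model V (range (\<lambda>(x, s). (x, 2 * (x \<bullet> c) + (r\<^sup>2 - c \<bullet> c) * s, s)))
    ((1 / (1 - 2 * r\<^sup>2)) *\<^sub>R c, (r\<^sup>2 + c \<bullet> c) * (1 / (1 - 2 * r\<^sup>2)), 1 / (1 - 2 * r\<^sup>2)) d"
    using G diameter_graph_dist_le[of V E] by (intro diameter_model_sphere[OF _ _ _ r assms(3)]) (auto simp: diameter_graph_def)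
  then interpret diameter_model V "range (\<lambda>(x, s). (x, 2 * (x \<bullet> c) + (r\<^sup>2 - c \<bullet> c) * s, s))"
    "((1 / (1 - 2 * r\<^sup>2)) *\<^sub>R c, (r\<^sup>2 + c \<bullet> c) * (1 / (1 - 2 * r\<^sup>2)), 1 / (1 - 2 * r\<^sup>2))" d .
  show "card (cliques d V E) \<le> n"
    using card_unit_cliques_le[OF assms(1) order_refl] G by (simp add: cliques_eq_unit_cliques)
qed

end
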